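(* Let $d\ge 1$, $N\ge 1$ be integers and let $K:[0,1]\to\mathbb{R}^+$ be a positive, decreasing, Lipschitz continuous function. There is a set of Lebesgue measure zero in $\mathbb{R}^{Nd}\times\mathbb{R}^{Nd}$ such that for every $(X,V)=(x_1,\dots,x_N,v_1,\dots,v_N)$ outside it there exists a unique global solution $$\left(X^N(t,X,V),V^N(t,X,V)\right)\in C^1(\mathbb{R}^+,\mathbb{R}^{dN})\times C(\mathbb{R}^+,\mathbb{R}^{dN})$$ of the topological Cucker-Smale agent system (defined in the context) with initial datum $(X,V)$. Moreover, given $R_x>0$ and $R_v>0$, if $|x_i|\le R_x$ and $|v_i|\le R_v$ for all $i=1,\dots,N$, then for all $i$ and all $t\ge 0$ $$|X_i(t)|\le R_x+tR_v,\qquad |V_i(t)|\le R_v,$$ and therefore $t\mapsto V_i(t,X,V)$ has Lipschitz constant bounded by $2R_vK(0)$.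
   Context: The topological Cucker-Smale agent system is $$\dot X_i(t)=V_i(t),\qquad \dot V_i(t)=\frac1N\sum_{j=1}^N p_{ij}(t)\,(V_j(t)-V_i(t)),\qquad i=1,\dots,N,$$ with $X_i,V_i\in\mathbb{R}^d$, $p_{ij}=K\bigl(M(X_i,|X_i-X_j|)\bigr)$ and $M(X_i,r)=\frac1N\#\{k\in\{1,\dots,N\}:|X_k-X_i|\le r\}$. Notion of solution. The right-hand side of the second equation is discontinuous where two agents $i,j$ have the same distance from a third agent $k$ (a tie). If $|x_i-x_k|=|x_j-x_k|$ with $x_i,x_j,x_k$ different and, writing $\hat n_{ab}=(x_a-x_b)/|x_a-x_b|$, $(v_i-v_k)\cdot\hat n_{ik}>(v_j-v_k)\cdot\hat n_{jk}$, the force on agent $k$ is evaluated as if $|x_i-x_k|>|x_j-x_k|$ for later times and as if $|x_i-x_k|<|x_j-x_k|$ for earlier times, so that $\dot V_k$ may jump at such a time. Accordingly, a solution is a pair with $X_i\in C^1$, $\dot X_i=V_i$, and $V_i$ continuous satisfying the second equation in integrated form, $V_i(t)=V_i(0)+\int_0^t \frac1N\sum_j p_{ij}(s)(V_j(s)-V_i(s))\,ds$ for all $t\ge 0$. *)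

theory Defs
  imports "HOL-Analysis.Analysis"
begin

text \<open>
  The \<open>N\<close> agents are indexed by the finite type \<open>'n\<close>, so \<open>N = CARD('n)\<close>; their positions and
  velocities in \<open>real ^ 'd\<close> are collected in vectors of type \<open>real ^ 'd ^ 'n\<close>.
\<close>

definition rank_mass :: "real ^ 'd ^ 'n \<Rightarrow> 'n \<Rightarrow> real \<Rightarrow> real" where
  "rank_mass x i r = real (card {k. norm (x $ k - x $ i) \<le> r}) / real CARD('n)"

definition comm_weight :: "(real \<Rightarrow> real) \<Rightarrow> real ^ 'd ^ 'n \<Rightarrow> 'n \<Rightarrow> 'n \<Rightarrow> real" where
  "comm_weight K x i j = K (rank_mass x i (norm (x $ i - x $ j)))"

definition alignment_force ::
    "(real \<Rightarrow> real) \<Rightarrow> real ^ 'd ^ 'n \<Rightarrow> real ^ 'd ^ 'n \<Rightarrow> 'n \<Rightarrow> real ^ 'd" where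
  "alignment_force K x v i =
     (1 / real CARD('n)) *\<^sub>R (\<Sum>j\<in>UNIV. comm_weight K x i j *\<^sub>R (v $ j - v $ i))"

text \<open>
  Only the restrictions of \<open>X\<close> and \<open>V\<close> to \<open>t \<ge> 0\<close> matter. The velocity equation is taken in
  integrated form, so the one-sided evaluation of the force at a tie with distinct radial
  velocities plays no role: for fixed agents the times of such ties are isolated among all
  their tie times, hence countable.
  The integrand is bounded and Borel measurable on each \<open>{0..t}\<close> (\<open>X\<close> and \<open>V\<close> being
  continuous), so the gauge integral below coincides with the Lebesgue integral.
\<close>

definition topological_CS_solution ::
    "(real \<Rightarrow> real) \<Rightarrow> real ^ 'd ^ 'n \<Rightarrow> real ^ 'd ^ 'n \<Rightarrow>
     (real \<Rightarrow> real ^ 'd ^ 'n) \<Rightarrow> (real \<Rightarrow> real ^ 'd ^ 'n) \<Rightarrow> bool" where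
  "topological_CS_solution K x v X V \<longleftrightarrow>
     X 0 = x \<and> V 0 = v \<and>
     continuous_on {0..} V \<and>
     (\<forall>t\<ge>0. (X has_vector_derivative V t) (at t within {0..})) \<and>
     (\<forall>i. \<forall>t\<ge>0.
        (\<lambda>s. alignment_force K (X s) (V s) i) integrable_on {0..t} \<and>
        V t $ i = V 0 $ i + integral {0..t} (\<lambda>s. alignment_force K (X s) (V s) i))"

end

theory Submission
  imports Defs "HOL-Complex_Analysis.Great_Picard"
begin

text \<open>
  For distinct agents \<open>c\<close>, \<open>i\<close>, \<open>j\<close> put \<open>a = x\<^sub>i - x\<^sub>j\<close> and \<open>b = x\<^sub>i + x\<^sub>j - 2 x\<^sub>c\<close>, so that the tie
  function \<open>|x\<^sub>i - x\<^sub>c|\<^sup>2 - |x\<^sub>j - x\<^sub>c|\<^sup>2\<close> is \<open>a \<bullet> b\<close>; its time derivative depends only on positions and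
  velocities. At a state where no tie function vanishes together with its derivative, the ranking
  just after the present time is determined by the state, and a contraction argument gives
  uniqueness. The remaining tangential states have codimension two.

  Existence and the null set are obtained together, without a flow, from an explicit splitting
  scheme: accelerate with frozen positions, then move. Each step is piecewise linear and distorts
  volume by a factor \<open>exp (O(h))\<close>. A trajectory through a tangential state on \<open>[0, T]\<close> is found in one of
  finitely many open sets at one of finitely many grid times, and the total volume of these sets
  can be made arbitrarily small because of the codimension. By Fatou, almost every initial datum
  has a subsequence of discrete trajectories that avoid all these sets; its limit has no tangential
  states, hence finitely many ties on bounded intervals, and solves the system by dominated
  convergence.
\<close>

text \<open>The obstacle is that the force jumps at ties: before anything is known about ties there
  is no flow whose volume distortion could be estimated, and discrete forces need not converge. The
  scheme supplies what a flow would, namely maps defined for every datum, of which only the volume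
  of preimages is estimated, uniformly in the step on bounded time intervals. Codimension two is
  what the count requires: a state moving at bounded speed must be observed at about 1/delta grid
  times to be seen within delta of a bad set, so one small condition of size delta would leave a
  total of order one, whereas two independent ones leave a total that tends to zero. The volume
  bound does not improve as the step shrinks, hence only a liminf of bad sets can be controlled, and
  the good steps form a subsequence that depends on the datum. Different subsequences cannot lead to
  different solutions, because uniqueness asks transversality of one solution only and allows any
  competitor.\<close>

section \<open>Volume of linear preimages and packings\<close>

lemma emeasure_linear_vimage_open_le:
  fixes T :: "'a::euclidean_space \<Rightarrow> 'a"
  assumes lin: "linear T" and c: "c > 0" and exp: "\<And>z. c * norm z \<le> norm (T z)"
    and U: "open U"
  shows "emeasure lborel (T -` U) \<le> ennreal ((1/c) ^ DIM('a)) * emeasure lborel U"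
proof -
  have "inj T"
    unfolding linear_injective_0[OF lin]
  proof (intro allI impI)
    fix z assume "T z = 0"
    with exp[of z] c show "z = 0" by (simp add: mult_le_0_iff)
  qed
  then obtain g where g: "linear g" "\<And>x. T (g x) = x" "\<And>x. g (T x) = x"
    using linear_injective_isomorphism[OF lin] by metis
  have contT: "continuous_on UNIV T"
    using lin by (simp add: linear_continuous_on linear_linear)
  have Tm: "T -` B \<in> sets borel" if "B \<in> sets borel" for B
    using measurable_sets_borel[OF borel_measurable_continuous_onI[OF contT] that] by simp
  let ?K = "{(a, r). 0 < r \<and> cball a r \<subseteq> U}"
  have r: "0 < snd i" if "i \<in> ?K" for i using that by auto
  have S: "\<exists>i. i \<in> ?K \<and> x \<in> cball (fst i) (snd i) \<and> snd i < d" if "x \<in> U" "0 < d" for x d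
  proof -
    obtain e where "e > 0" "cball x e \<subseteq> U" using U \<open>x \<in> U\<close> open_contains_cball by blast
    then have "cball x (min e (d/2)) \<subseteq> U" by (auto simp: subset_eq)
    with \<open>e > 0\<close> \<open>0 < d\<close> show ?thesis by (intro exI[of _ "(x, min e (d/2))"]) auto
  qed
  obtain C where C: "countable C" "C \<subseteq> ?K"
    "pairwise (\<lambda>i j. disjnt (cball (fst i) (snd i)) (cball (fst j) (snd j))) C"
    "negligible (U - (\<Union>i\<in>C. cball (fst i) (snd i)))"
    by (rule Vitali_covering_theorem_cballs[of ?K snd U fst, OF r S]) (assumption | rule that)+
  let ?B = "\<lambda>i. cball (fst i) (snd i)"
  let ?N = "U - (\<Union>i\<in>C. ?B i)"
  have disj: "disjoint_family_on ?B C"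
    using C(3) by (auto simp: disjoint_family_on_def pairwise_def disjnt_def)
  then have disj': "disjoint_family_on (\<lambda>i. T -` ?B i) C"
    unfolding disjoint_family_on_def by blast
  have "T -` ?N = g ` ?N"
  proof (intro set_eqI iffI)
    fix z assume "z \<in> T -` ?N"
    then have "T z \<in> ?N" by (simp only: vimage_eq)
    then show "z \<in> g ` ?N" using g(3)[of z] by (metis image_eqI)
  next
    fix z assume "z \<in> g ` ?N"
    then obtain y where "y \<in> ?N" "z = g y" by blast
    then show "z \<in> T -` ?N" by (simp only: vimage_eq g)
  qed
  moreover have "negligible (g ` ?N)"
    by (rule negligible_differentiable_image_negligible[OF order_refl C(4)])
      (rule linear_imp_differentiable_on[OF g(1)])
  ultimately have negN: "negligible (T -` ?N)" by simp
  have Nb: "?N \<in> sets borel"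
    using U C(1) by (intro sets.Diff sets.countable_UN') auto
  have N0: "emeasure lborel (T -` ?N) = 0"
    using negN Tm[OF Nb] by (simp add: negligible_iff_null_sets null_sets_def)
  have ball: "emeasure lborel (T -` ?B i) \<le> ennreal ((1/c) ^ DIM('a)) * emeasure lborel (?B i)"
    if "i \<in> C" for i
  proof -
    have pos: "snd i > 0" using that C(2) by auto
    have "T -` ?B i \<subseteq> cball (g (fst i)) (snd i / c)"
    proof
      fix z assume "z \<in> T -` ?B i"
      then have "norm (T (z - g (fst i))) \<le> snd i"
        by (simp add: linear_diff[OF lin] g dist_norm norm_minus_commute)
      with exp[of "z - g (fst i)"] have "c * norm (z - g (fst i)) \<le> snd i" by simp
      with c show "z \<in> cball (g (fst i)) (snd i / c)"
        by (simp add: dist_norm norm_minus_commute field_simps)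
    qed
    then have "emeasure lborel (T -` ?B i) \<le> emeasure lborel (cball (g (fst i)) (snd i / c))"
      by (intro emeasure_mono) auto
    also have "\<dots> = ennreal ((1/c) ^ DIM('a)) * emeasure lborel (?B i)"
      using pos c
      by (simp add: emeasure_cball ennreal_mult[symmetric] field_simps)
    finally show ?thesis .
  qed
  have "T -` U \<subseteq> T -` ?N \<union> (\<Union>i\<in>C. T -` ?B i)" by auto
  then have "emeasure lborel (T -` U) \<le> emeasure lborel (T -` ?N \<union> (\<Union>i\<in>C. T -` ?B i))"
    using C(1) Nb by (intro emeasure_mono) (auto intro!: sets.Un sets.countable_UN' Tm)
  also have "\<dots> \<le> emeasure lborel (T -` ?N) + emeasure lborel (\<Union>i\<in>C. T -` ?B i)"
    using C(1) Nb by (intro emeasure_subadditive) (auto intro!: sets.countable_UN' Tm)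
  also have "\<dots> = (\<integral>\<^sup>+i. emeasure lborel (T -` ?B i) \<partial>count_space C)"
    using C(1) disj' by (subst emeasure_UN_countable) (auto simp: N0 intro!: Tm)
  also have "\<dots> \<le> (\<integral>\<^sup>+i. ennreal ((1/c) ^ DIM('a)) * emeasure lborel (?B i) \<partial>count_space C)"
    by (intro nn_integral_mono) (simp add: ball)
  also have "\<dots> = ennreal ((1/c) ^ DIM('a)) * emeasure lborel (\<Union>i\<in>C. ?B i)"
    using C(1) disj by (subst emeasure_UN_countable) (auto simp: nn_integral_cmult)
  also have "\<dots> \<le> ennreal ((1/c) ^ DIM('a)) * emeasure lborel U"
  proof (intro mult_left_mono emeasure_mono)
    show "(\<Union>i\<in>C. ?B i) \<subseteq> U"
    proof (rule UN_least)
      fix i assume "i \<in> C"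
      with C(2) show "?B i \<subseteq> U" by (cases i) auto
    qed
  qed (use U in auto)
  finally show ?thesis .
qed

lemma emeasure_linear_vimage_le:
  fixes T :: "'a::euclidean_space \<Rightarrow> 'a"
  assumes lin: "linear T" and c: "c > 0" and exp: "\<And>z. c * norm z \<le> norm (T z)"
    and A: "A \<in> sets borel"
  shows "emeasure lborel (T -` A) \<le> ennreal ((1/c) ^ DIM('a)) * emeasure lborel A"
proof (rule ennreal_le_epsilon)
  fix e :: real assume "0 < e"
  let ?C = "(1/c) ^ DIM('a)"
  have C0: "?C > 0" and "c \<noteq> 0" using c by simp_all
  then have "0 < e / ?C" using \<open>0 < e\<close> by simp
  then obtain U where U: "open U" "A \<subseteq> U" "emeasure lborel (U - A) \<le> ennreal (e / ?C)"
    using outer_regular_lborel_le[OF A] by metis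
  have "continuous_on UNIV T"
    using lin by (simp add: linear_continuous_on linear_linear)
  then have "open (T -` U)" using U(1) by (simp add: open_vimage)
  then have "emeasure lborel (T -` A) \<le> emeasure lborel (T -` U)"
    using U(2) by (intro emeasure_mono) auto
  also have "\<dots> \<le> ennreal ?C * emeasure lborel U"
    by (rule emeasure_linear_vimage_open_le[OF lin c exp U(1)])
  also have "emeasure lborel U = emeasure lborel (A \<union> (U - A))" using U(2) by (auto intro!: arg_cong[where f = "emeasure lborel"])
  also have "\<dots> \<le> emeasure lborel A + emeasure lborel (U - A)"
    using A U(1) by (intro emeasure_subadditive) auto
  also have "\<dots> \<le> emeasure lborel A + ennreal (e / ?C)"
    using U(3) by (intro add_left_mono)
  finally have "emeasure lborel (T -` A) \<le> ennreal ?C * (emeasure lborel A + ennreal (e / ?C))"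
    by (simp add: mult_left_mono)
  also have "\<dots> = ennreal ?C * emeasure lborel A + ennreal e"
    using C0 \<open>0 < e\<close> \<open>c \<noteq> 0\<close> by (simp add: distrib_left ennreal_mult[symmetric])
  finally show "emeasure lborel (T -` A) \<le> ennreal ?C * emeasure lborel A + ennreal e" .
qed

lemma emeasure_lborel_translation:
  fixes A :: "'a::euclidean_space set"
  assumes "A \<in> sets borel"
  shows "(+) a ` A \<in> sets borel" "emeasure lborel ((+) a ` A) = emeasure lborel A"
proof -
  have eq: "(+) a ` A = (+) (-a) -` A" 
    by (auto simp: image_iff intro!: bexI[of _ "_ - a"])
  have m: "(+) (-a) \<in> borel_measurable borel" by measurable
  show "(+) a ` A \<in> sets borel"
    unfolding eq using measurable_sets_borel[OF m assms] by simp
  have "emeasure lborel A = emeasure (distr lborel borel ((+) (-a))) A"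
    by (simp only: lborel_distr_plus)
  also have "\<dots> = emeasure lborel ((+) (-a) -` A)"
    using assms by (subst emeasure_distr) auto
  finally show "emeasure lborel ((+) a ` A) = emeasure lborel A" by (simp add: eq)
qed

text \<open>
  The conditions on \<open>\<alpha>\<close>, \<open>\<beta>\<close>, \<open>p\<close> make the \<open>n\<^sup>2\<close> translates \<open>A + k u + l w\<close> pairwise disjoint.
\<close>

lemma emeasure_packing_le:
  fixes A Q :: "'a::euclidean_space set" and \<alpha> \<beta> p :: "'a \<Rightarrow> real"
  assumes A: "A \<in> sets borel" and Q: "Q \<in> sets borel"
    and bd: "\<And>z. z \<in> A \<Longrightarrow> 2 * s \<le> \<bar>p z\<bar> \<and> \<bar>\<alpha> z\<bar> < s \<and> \<bar>\<beta> z\<bar> < s"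
    and p: "\<And>z k l. p (z + real k *\<^sub>R u + real l *\<^sub>R w) = p z"
    and \<alpha>: "\<And>z k l. \<alpha> (z + real k *\<^sub>R u + real l *\<^sub>R w) = \<alpha> z + real k * p z"
    and \<beta>: "\<And>z l. \<beta> (z + real l *\<^sub>R w) = \<beta> z + real l * p z"
    and sub: "\<And>z k l. z \<in> A \<Longrightarrow> k < n \<Longrightarrow> l < n \<Longrightarrow> z + real k *\<^sub>R u + real l *\<^sub>R w \<in> Q"
  shows "ennreal (real n ^ 2) * emeasure lborel A \<le> emeasure lborel Q"
proof -
  let ?I = "{..<n} \<times> {..<n}"
  let ?A = "\<lambda>(k, l). (+) (real k *\<^sub>R u + real l *\<^sub>R w) ` A"
  \<comment> \<open>Two different multiples of q are at least 2s apart, but the residuals r and r'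
    differ by less than 2s.\<close>
  have key: "k = k'" if "real k * q + r = real k' * q + r'" "2 * s \<le> \<bar>q\<bar>" "\<bar>r\<bar> < s" "\<bar>r'\<bar> < s"
    for k k' :: nat and q r r' s
  proof (rule ccontr)
    assume "k \<noteq> k'"
    then have "1 \<le> \<bar>real k - real k'\<bar>" by linarith
    then have "\<bar>q\<bar> \<le> \<bar>real k - real k'\<bar> * \<bar>q\<bar>"
      by (metis abs_ge_zero mult_1 mult_right_mono)
    also have "\<dots> = \<bar>r' - r\<bar>"
      using that(1) by (simp add: abs_mult[symmetric] algebra_simps)
    finally show False using that(2-4) by linarith
  qed
  \<comment> \<open>The behaviour of \<open>\<beta>\<close> along \<open>u\<close> is unknown. So k
    is recovered from \<open>\<alpha>\<close> first, and \<open>\<beta>\<close> is consulted only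
    after the multiples of \<open>u\<close> have been cancelled.\<close>
  have inj: "k = k' \<and> l = l'"
    if z: "z \<in> A" "z' \<in> A"
      and e: "z + real k *\<^sub>R u + real l *\<^sub>R w = z' + real k' *\<^sub>R u + real l' *\<^sub>R w"
    for z z' k l k' l'
  proof -
    have pp: "p z = p z'" using p[of z k l] p[of z' k' l'] e by simp
    have "real k * p z + \<alpha> z = real k' * p z + \<alpha> z'"
      using \<alpha>[of z k l] \<alpha>[of z' k' l'] e pp by simp
    then have k: "k = k'" using key bd z by meson
    then have "z + real l *\<^sub>R w = z' + real l' *\<^sub>R w" using e by (simp add: algebra_simps)
    then have "real l * p z + \<beta> z = real l' * p z + \<beta> z'"
      using \<beta>[of z l] \<beta>[of z' l'] pp by simp
    then have "l = l'" using key bd z by meson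
    with k show ?thesis by simp
  qed
  have "disjoint_family_on ?A ?I"
    unfolding disjoint_family_on_def
  proof (intro ballI impI equals0I)
    fix i j x assume ij: "i \<in> ?I" "j \<in> ?I" "i \<noteq> j" and x: "x \<in> ?A i \<inter> ?A j"
    obtain k l k' l' where eq: "i = (k, l)" "j = (k', l')" by (metis surj_pair)
    from x obtain z z' where "z \<in> A" "z' \<in> A"
      "x = z + real k *\<^sub>R u + real l *\<^sub>R w" "x = z' + real k' *\<^sub>R u + real l' *\<^sub>R w"
      unfolding eq by (auto simp: algebra_simps)
    with inj[of z z' k l k' l'] ij(3) eq show False by simp
  qed
  then have "emeasure lborel (\<Union>i\<in>?I. ?A i) = (\<Sum>i\<in>?I. emeasure lborel (?A i))"
    by (intro sum_emeasure[symmetric])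
      (auto simp: image_subset_iff emeasure_lborel_translation(1)[OF A])
  also have "\<dots> = (\<Sum>i\<in>?I. emeasure lborel A)"
    by (intro sum.cong) (auto simp: emeasure_lborel_translation(2)[OF A])
  also have "\<dots> = ennreal (real n ^ 2) * emeasure lborel A"
    by (simp add: power2_eq_square ennreal_of_nat_eq_real_of_nat)
  finally have "ennreal (real n ^ 2) * emeasure lborel A = emeasure lborel (\<Union>i\<in>?I. ?A i)" ..
  also have "\<dots> \<le> emeasure lborel Q"
    using Q sub by (intro emeasure_mono) (auto simp: algebra_simps)
  finally show ?thesis .
qed

section \<open>The kick-drift scheme\<close>

type_synonym ('d, 'n) phase = "(real ^ 'd ^ 'n) \<times> (real ^ 'd ^ 'n)"

definition force_field :: "(real \<Rightarrow> real) \<Rightarrow> real ^ 'd ^ 'n \<Rightarrow> real ^ 'd ^ 'n \<Rightarrow> real ^ 'd ^ 'n" where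
  "force_field K x v = (\<chi> i. alignment_force K x v i)"

text \<open>The weights depend on the positions only through the cardinalities of these sets, so
  only finitely many forces are possible as functions of the velocities.\<close>

definition closer :: "real ^ 'd ^ 'n \<Rightarrow> 'n \<Rightarrow> 'n \<Rightarrow> 'n set" where
  "closer x i j = {k. norm (x $ k - x $ i) \<le> norm (x $ i - x $ j)}"

text \<open>Freezing the ranking to a pattern \<open>\<sigma>\<close> makes the force linear in the
  velocities. The pattern ranges over a finite type and need not come from any positions.\<close>

definition ranked_field ::
    "(real \<Rightarrow> real) \<Rightarrow> ('n \<Rightarrow> 'n \<Rightarrow> 'n set) \<Rightarrow> real ^ 'd ^ 'n \<Rightarrow> real ^ 'd ^ 'n" where
  "ranked_field K \<sigma> v = (\<chi> i. (1 / real CARD('n)) *\<^sub>R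
     (\<Sum>j\<in>UNIV. K (real (card (\<sigma> i j)) / real CARD('n)) *\<^sub>R (v $ j - v $ i)))"

definition kick :: "(real \<Rightarrow> real) \<Rightarrow> real \<Rightarrow> ('d::finite, 'n::finite) phase \<Rightarrow> ('d, 'n) phase" where
  "kick K h z = (fst z, snd z + h *\<^sub>R force_field K (fst z) (snd z))"

definition drift :: "real \<Rightarrow> ('d::finite, 'n::finite) phase \<Rightarrow> ('d, 'n) phase" where
  "drift h z = (fst z + h *\<^sub>R snd z, snd z)"

definition cs_step where
  "cs_step K h z = drift h (kick K h z)"

text \<open>Piecewise constant in time, hence with jumps; they cause the extra \<open>h\<close> in
  the increment bounds.\<close>

definition cs_scheme where
  "cs_scheme K h t z = (cs_step K h ^^ nat \<lfloor>t / h\<rfloor>) z"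

lemma comm_weight_closer:
  "comm_weight K x i j = K (real (card (closer x i j)) / real CARD('n))"
  for x :: "real ^ 'd ^ 'n"
  by (simp add: comm_weight_def rank_mass_def closer_def)

lemma force_field_ranked: "force_field K x v = ranked_field K (closer x) v"
  by (simp add: force_field_def ranked_field_def alignment_force_def comm_weight_closer vec_eq_iff)

lemma linear_ranked_field: "linear (ranked_field K \<sigma>)"
  by (rule linearI)
    (simp_all add: ranked_field_def vec_eq_iff sum.distrib[symmetric] scaleR_sum_right algebra_simps)

section \<open>A priori bounds for the force and the discrete trajectories\<close>

locale cs_kernel =
  fixes K :: "real \<Rightarrow> real"
  assumes K_pos: "\<And>r. r \<in> {0..1} \<Longrightarrow> 0 < K r"
    and K_decreasing: "antimono_on {0..1} K"
begin

lemma K0_pos: "0 < K 0"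
  using K_pos by simp

lemma K_frac:
  fixes S :: "'n::finite set"
  shows "0 \<le> K (real (card S) / real CARD('n))" "K (real (card S) / real CARD('n)) \<le> K 0"
proof -
  have r: "real (card S) / real CARD('n) \<in> {0..1}"
    by (simp add: card_mono divide_le_eq_1)
  show "0 \<le> K (real (card S) / real CARD('n))" using K_pos[OF r] by simp
  show "K (real (card S) / real CARD('n)) \<le> K 0"
    by (rule monotone_onD[OF K_decreasing _ r]) (use r in auto)
qed

lemma norm_ranked_component_le:
  fixes v :: "real ^ 'd ^ 'n"
  assumes "\<And>j. norm (v $ j) \<le> R"
  shows "norm (ranked_field K \<sigma> v $ i) \<le> 2 * K 0 * R"
proof -
  have "norm (\<Sum>j\<in>UNIV. K (real (card (\<sigma> i j)) / real CARD('n)) *\<^sub>R (v $ j - v $ i))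
      \<le> (\<Sum>j\<in>(UNIV::'n set). K 0 * (2 * R))"
  proof (rule sum_norm_le)
    fix j
    have "norm (v $ j - v $ i) \<le> 2 * R"
      using norm_triangle_ineq4[of "v $ j" "v $ i"] assms[of i] assms[of j] by linarith
    then show "norm (K (real (card (\<sigma> i j)) / real CARD('n)) *\<^sub>R (v $ j - v $ i)) \<le> K 0 * (2 * R)"
      using K_frac[of "\<sigma> i j"] by (auto intro!: mult_mono)
  qed
  then show ?thesis
    by (simp add: ranked_field_def divide_simps) (simp add: algebra_simps)
qed

lemma norm_ranked_field_le:
  fixes v :: "real ^ 'd ^ 'n"
  shows "norm (ranked_field K \<sigma> v) \<le> 2 * real CARD('n) * K 0 * norm v"
proof -
  have "norm (ranked_field K \<sigma> v) \<le> (\<Sum>i\<in>UNIV. norm (ranked_field K \<sigma> v $ i))"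
    unfolding norm_vec_def by (rule L2_set_le_sum) simp
  also have "\<dots> \<le> (\<Sum>i\<in>(UNIV::'n set). 2 * K 0 * norm v)"
    by (intro sum_mono norm_ranked_component_le Finite_Cartesian_Product.norm_nth_le)
  finally show ?thesis by (simp add: algebra_simps)
qed

text \<open>A discrete maximum principle: the weights \<open>w j\<close> are nonnegative and,
  because h K(0) is at most 1, have sum at most 1, so each new velocity is a convex combination of
  the old ones.\<close>

lemma norm_snd_kick_le:
  fixes z :: "('d::finite, 'n::finite) phase"
  assumes h: "0 \<le> h" "h * K 0 \<le> 1" and R: "\<And>j. norm (snd z $ j) \<le> R"
  shows "norm (snd (kick K h z) $ i) \<le> R"
proof -
  let ?v = "snd z"
  define w where "w j = h * K (real (card (closer (fst z) i j)) / real CARD('n)) / real CARD('n)" for j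
  have w0: "0 \<le> w j" for j using h K_frac[of "closer (fst z) i j"] by (simp add: w_def)
  have "(\<Sum>j\<in>UNIV. w j) \<le> (\<Sum>j\<in>(UNIV::'n set). h * K 0 / real CARD('n))"
    unfolding w_def using h K_frac by (intro sum_mono divide_right_mono mult_left_mono) auto
  also have "\<dots> \<le> 1" using h by simp
  finally have w1: "(\<Sum>j\<in>UNIV. w j) \<le> 1" .
  have "snd (kick K h z) $ i = ?v $ i + (\<Sum>j\<in>UNIV. w j *\<^sub>R (?v $ j - ?v $ i))"
    by (simp add: w_def kick_def force_field_ranked ranked_field_def scaleR_sum_right)
  also have "\<dots> = (1 - (\<Sum>j\<in>UNIV. w j)) *\<^sub>R ?v $ i + (\<Sum>j\<in>UNIV. w j *\<^sub>R ?v $ j)"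
    by (simp add: scaleR_diff_right sum_subtractf scaleR_sum_left algebra_simps)
  finally have "norm (snd (kick K h z) $ i)
      \<le> norm ((1 - (\<Sum>j\<in>UNIV. w j)) *\<^sub>R ?v $ i) + norm (\<Sum>j\<in>UNIV. w j *\<^sub>R ?v $ j)"
    by (simp only: norm_triangle_ineq)
  also have "\<dots> \<le> (1 - (\<Sum>j\<in>UNIV. w j)) * R + (\<Sum>j\<in>UNIV. w j * R)"
    using w0 w1 R by (intro add_mono sum_norm_le) (simp_all add: mult_left_mono)
  also have "\<dots> = R" by (simp add: sum_distrib_left algebra_simps)
  finally show ?thesis .
qed

lemma cs_step_bounds:
  fixes z :: "('d::finite, 'n::finite) phase"
  assumes h: "0 \<le> h" "h * K 0 \<le> 1" and R: "\<And>j. norm (snd z $ j) \<le> R"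
  shows "norm (snd (cs_step K h z) $ i) \<le> R"
    and "norm (snd (cs_step K h z) $ i - snd z $ i) \<le> 2 * K 0 * R * h"
    and "norm (fst (cs_step K h z) $ i - fst z $ i) \<le> R * h"
proof -
  show 1: "norm (snd (cs_step K h z) $ i) \<le> R"
    using norm_snd_kick_le[OF h R] by (simp add: cs_step_def drift_def)
  show "norm (snd (cs_step K h z) $ i - snd z $ i) \<le> 2 * K 0 * R * h"
    using norm_ranked_component_le[OF R, of "closer (fst z)" i] h
    by (simp add: cs_step_def drift_def kick_def force_field_ranked mult.commute[of _ h] mult_left_mono)
  show "norm (fst (cs_step K h z) $ i - fst z $ i) \<le> R * h"
    using norm_snd_kick_le[OF h R, of i] h
    by (simp add: cs_step_def drift_def kick_def mult.commute[of _ h] mult_left_mono)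
qed

lemma cs_iterate_bounds:
  fixes x v :: "real ^ 'd ^ 'n"
  assumes h: "0 \<le> h" "h * K 0 \<le> 1"
    and Rx: "\<And>j. norm (x $ j) \<le> Rx" and R: "\<And>j. norm (v $ j) \<le> R"
  shows "norm (snd ((cs_step K h ^^ k) (x, v)) $ i) \<le> R"
    and "norm (fst ((cs_step K h ^^ k) (x, v)) $ i) \<le> Rx + real k * h * R"
proof -
  have V: "\<forall>i. norm (snd ((cs_step K h ^^ k) (x, v)) $ i) \<le> R" for k
  proof (induction k)
    case (Suc k)
    then have "norm (snd (cs_step K h ((cs_step K h ^^ k) (x, v))) $ i) \<le> R" for i
      by (intro cs_step_bounds(1)[OF h]) blast
    then show ?case by simp
  qed (simp add: R)
  then show "norm (snd ((cs_step K h ^^ k) (x, v)) $ i) \<le> R" by blast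
  show "norm (fst ((cs_step K h ^^ k) (x, v)) $ i) \<le> Rx + real k * h * R"
  proof (induction k)
    case (Suc k)
    let ?z = "(cs_step K h ^^ k) (x, v)"
    have "norm (fst (cs_step K h ?z) $ i - fst ?z $ i) \<le> R * h"
      using cs_step_bounds(3)[OF h] V by blast
    moreover have "norm (fst (cs_step K h ?z) $ i)
        \<le> norm (fst ?z $ i) + norm (fst (cs_step K h ?z) $ i - fst ?z $ i)"
      by (rule norm_triangle_sub)
    ultimately show ?case using Suc by (simp add: algebra_simps)
  qed (simp add: Rx)
qed

lemma cs_iterate_increment_le:
  fixes x v :: "real ^ 'd ^ 'n"
  assumes h: "0 \<le> h" "h * K 0 \<le> 1" and R: "\<And>j. norm (v $ j) \<le> R" and kl: "l \<le> k"
  shows "norm (snd ((cs_step K h ^^ k) (x, v)) $ i - snd ((cs_step K h ^^ l) (x, v)) $ i)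
      \<le> 2 * K 0 * R * (h * (real k - real l))"
    and "norm (fst ((cs_step K h ^^ k) (x, v)) $ i - fst ((cs_step K h ^^ l) (x, v)) $ i)
      \<le> R * (h * (real k - real l))"
proof -
  let ?z = "\<lambda>k. (cs_step K h ^^ k) (x, v)"
  have V: "norm (snd (?z k) $ i) \<le> R" for k i
    by (rule cs_iterate_bounds(1)[OF h Finite_Cartesian_Product.norm_nth_le R])
  show "norm (snd (?z k) $ i - snd (?z l) $ i) \<le> 2 * K 0 * R * (h * (real k - real l))"
    using kl
  proof (induction k rule: dec_induct)
    case (step k)
    have "norm (snd (?z (Suc k)) $ i - snd (?z k) $ i) \<le> 2 * K 0 * R * h"
      using cs_step_bounds(2)[OF h V] by simp
    with step(3) norm_triangle_ineq[of "snd (?z (Suc k)) $ i - snd (?z k) $ i" "snd (?z k) $ i - snd (?z l) $ i"]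
    show ?case by (simp add: algebra_simps)
  qed simp
  show "norm (fst (?z k) $ i - fst (?z l) $ i) \<le> R * (h * (real k - real l))"
    using kl
  proof (induction k rule: dec_induct)
    case (step k)
    have "norm (fst (?z (Suc k)) $ i - fst (?z k) $ i) \<le> R * h"
      using cs_step_bounds(3)[OF h V] by simp
    with step(3) norm_triangle_ineq[of "fst (?z (Suc k)) $ i - fst (?z k) $ i" "fst (?z k) $ i - fst (?z l) $ i"]
    show ?case by (simp add: algebra_simps)
  qed simp
qed

lemma cs_scheme_bounds:
  fixes x v :: "real ^ 'd ^ 'n"
  assumes h: "0 < h" "h * K 0 \<le> 1" and t: "0 \<le> t"
    and Rx: "\<And>j. norm (x $ j) \<le> Rx" and R: "\<And>j. norm (v $ j) \<le> R"
  shows "norm (snd (cs_scheme K h t (x, v)) $ i) \<le> R"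
    and "norm (fst (cs_scheme K h t (x, v)) $ i) \<le> Rx + t * R"
proof -
  show "norm (snd (cs_scheme K h t (x, v)) $ i) \<le> R"
    unfolding cs_scheme_def using h by (intro cs_iterate_bounds(1)[OF _ _ Rx R]) auto
  have "0 \<le> R" using R[of i] norm_ge_zero order_trans by blast
  have "real (nat \<lfloor>t / h\<rfloor>) * h \<le> t"
    using h t by (simp add: pos_le_divide_eq[symmetric])
  then have "Rx + real (nat \<lfloor>t / h\<rfloor>) * h * R \<le> Rx + t * R"
    using \<open>0 \<le> R\<close> by (simp add: mult_right_mono)
  moreover have "norm (fst (cs_scheme K h t (x, v)) $ i) \<le> Rx + real (nat \<lfloor>t / h\<rfloor>) * h * R"
    unfolding cs_scheme_def using h by (intro cs_iterate_bounds(2)[OF _ _ Rx R]) auto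
  ultimately show "norm (fst (cs_scheme K h t (x, v)) $ i) \<le> Rx + t * R" by linarith
qed

lemma cs_scheme_increment_le:
  fixes x v :: "real ^ 'd ^ 'n"
  assumes h: "0 < h" "h * K 0 \<le> 1" and t: "0 \<le> s" "s \<le> t" and R: "\<And>j. norm (v $ j) \<le> R"
  shows "norm (snd (cs_scheme K h t (x, v)) $ i - snd (cs_scheme K h s (x, v)) $ i)
      \<le> 2 * K 0 * R * (t - s + h)"
    and "norm (fst (cs_scheme K h t (x, v)) $ i - fst (cs_scheme K h s (x, v)) $ i)
      \<le> R * (t - s + h)"
proof -
  let ?k = "nat \<lfloor>t / h\<rfloor>" and ?l = "nat \<lfloor>s / h\<rfloor>"
  have R0: "0 \<le> R" using R[of i] norm_ge_zero order_trans by blast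
  have le: "?l \<le> ?k"
    using h t by (intro nat_mono floor_mono divide_right_mono) auto
  have "real ?k \<le> t / h" using h t by simp
  moreover have "s / h - 1 \<le> real ?l" using h t by linarith
  ultimately have "h * (real ?k - real ?l) \<le> h * (t / h - (s / h - 1))"
    using h by (intro mult_left_mono) auto
  also have "\<dots> = t - s + h" using h by (simp add: field_simps)
  finally have kl: "h * (real ?k - real ?l) \<le> t - s + h" .
  have "norm (snd (cs_scheme K h t (x, v)) $ i - snd (cs_scheme K h s (x, v)) $ i)
      \<le> 2 * K 0 * R * (h * (real ?k - real ?l))"
    unfolding cs_scheme_def using h by (intro cs_iterate_increment_le(1)[OF _ _ R le]) auto
  also have "\<dots> \<le> 2 * K 0 * R * (t - s + h)"
    using kl R0 K0_pos by (intro mult_left_mono) auto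
  finally show "norm (snd (cs_scheme K h t (x, v)) $ i - snd (cs_scheme K h s (x, v)) $ i)
      \<le> 2 * K 0 * R * (t - s + h)" .
  have "norm (fst (cs_scheme K h t (x, v)) $ i - fst (cs_scheme K h s (x, v)) $ i)
      \<le> R * (h * (real ?k - real ?l))"
    unfolding cs_scheme_def using h by (intro cs_iterate_increment_le(2)[OF _ _ R le]) auto
  also have "\<dots> \<le> R * (t - s + h)"
    using kl R0 by (intro mult_left_mono) auto
  finally show "norm (fst (cs_scheme K h t (x, v)) $ i - fst (cs_scheme K h s (x, v)) $ i)
      \<le> R * (t - s + h)" .
qed

end

section \<open>Volume distortion of the scheme\<close>

text \<open>These finitely many cells partition phase space, and the kick is linear on each. They
  are cut out by weak inequalities and negations of such, so they are Borel but in general neither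
  open nor closed.\<close>

lemma borel_closer_level:
  "{z :: ('d::finite, 'n::finite) phase. closer (fst z) = \<sigma>} \<in> sets borel"
proof -
  let ?S = "\<lambda>i j k. {z :: ('d, 'n) phase.
      norm (fst z $ k - fst z $ i) \<le> norm (fst z $ i - fst z $ j)}"
  have S: "?S i j k \<in> sets borel" for i j k
    by (intro borel_closed closed_Collect_le continuous_intros)
  have "{z :: ('d, 'n) phase. closer (fst z) = \<sigma>} = (\<Inter>i. \<Inter>j. \<Inter>k. {z. z \<in> ?S i j k \<longleftrightarrow> k \<in> \<sigma> i j})"
    by (auto simp: closer_def fun_eq_iff set_eq_iff)
  also have "\<dots> \<in> sets borel"
  proof (intro sets.countable_INT' countableI_type image_subsetI)
    fix i j k
    have "{z. z \<in> ?S i j k \<longleftrightarrow> k \<in> \<sigma> i j} = (if k \<in> \<sigma> i j then ?S i j k else - ?S i j k)"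
      by auto
    then show "{z. z \<in> ?S i j k \<longleftrightarrow> k \<in> \<sigma> i j} \<in> sets borel"
      using S borel_comp[OF S] by presburger
  qed auto
  finally show ?thesis .
qed

context cs_kernel
begin

text \<open>On the cell \<open>G \<sigma>\<close> the kick agrees with the linear map
  \<open>T \<sigma>\<close>, a perturbation of the identity of size O(h). Since a kick leaves
  positions unchanged, it maps each cell into itself; the pieces of the preimage then belong to
  disjoint parts of \<open>A\<close>, and the number of patterns does not enter the
  constant.\<close>

lemma emeasure_kick_vimage_le:
  fixes A :: "('d::finite, 'n::finite) phase set"
  assumes h: "0 \<le> h" "2 * real CARD('n) * K 0 * h < 1" and A: "A \<in> sets borel"
  shows "kick K h -` A \<in> sets borel"
    and "emeasure lborel (kick K h -` A) \<le>
      ennreal ((1 / (1 - 2 * real CARD('n) * K 0 * h)) ^ DIM(('d, 'n) phase))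
      * emeasure lborel A"
proof -
  let ?c = "1 - 2 * real CARD('n) * K 0 * h"
  define T where "T \<sigma> z = (fst z, snd z + h *\<^sub>R ranked_field K \<sigma> (snd z))"
    for \<sigma> and z :: "('d, 'n) phase"
  define G where "G \<sigma> = {z :: ('d, 'n) phase. closer (fst z) = \<sigma>}" for \<sigma>
  have G: "G \<sigma> \<in> sets borel" for \<sigma> unfolding G_def by (rule borel_closer_level)
  have lin: "linear (T \<sigma>)" for \<sigma>
    by (rule linearI)
      (simp_all add: T_def linear_add[OF linear_ranked_field] linear_scale[OF linear_ranked_field]
        algebra_simps)
  then have contT: "continuous_on UNIV (T \<sigma>)" for \<sigma>
    by (simp add: linear_continuous_on linear_linear)
  have exp: "?c * norm z \<le> norm (T \<sigma> z)" for \<sigma> z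
  proof -
    let ?w = "(0, h *\<^sub>R ranked_field K \<sigma> (snd z)) :: ('d, 'n) phase"
    have "norm ?w = h * norm (ranked_field K \<sigma> (snd z))" using h by (simp add: norm_Pair)
    also have "\<dots> \<le> h * (2 * real CARD('n) * K 0 * norm (snd z))"
      using h by (intro mult_left_mono norm_ranked_field_le)
    also have "\<dots> \<le> h * (2 * real CARD('n) * K 0 * norm z)"
      using h K0_pos norm_snd_le[of "snd z" "fst z"] by (intro mult_left_mono) auto
    finally have "norm ?w \<le> h * (2 * real CARD('n) * K 0 * norm z)" .
    moreover have "T \<sigma> z + - ?w = z" by (simp add: T_def prod_eq_iff)
    then have "norm z \<le> norm (T \<sigma> z) + norm ?w"
      by (metis norm_minus_cancel norm_triangle_ineq)
    ultimately show ?thesis by (simp add: algebra_simps)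
  qed
  have eq: "kick K h -` A = (\<Union>\<sigma>\<in>UNIV. T \<sigma> -` (A \<inter> G \<sigma>))"
    by (auto simp: kick_def T_def G_def force_field_ranked)
  have Tm: "T \<sigma> -` (A \<inter> G \<sigma>) \<in> sets borel" for \<sigma>
    using measurable_sets_borel[OF borel_measurable_continuous_onI[OF contT]] A G by auto
  show "kick K h -` A \<in> sets borel" unfolding eq using Tm by auto
  have "emeasure lborel (kick K h -` A) \<le> (\<Sum>\<sigma>\<in>UNIV. emeasure lborel (T \<sigma> -` (A \<inter> G \<sigma>)))"
    unfolding eq using Tm by (intro emeasure_subadditive_finite) auto
  also have "\<dots> \<le> (\<Sum>\<sigma>\<in>UNIV. ennreal ((1 / ?c) ^ DIM(('d, 'n) phase)) * emeasure lborel (A \<inter> G \<sigma>))"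
    using h A G by (intro sum_mono emeasure_linear_vimage_le lin exp) auto
  also have "\<dots> = ennreal ((1 / ?c) ^ DIM(('d, 'n) phase)) * emeasure lborel (\<Union>\<sigma>\<in>UNIV. A \<inter> G \<sigma>)"
    unfolding sum_distrib_left[symmetric] using A G
    by (subst sum_emeasure) (auto simp: disjoint_family_on_def G_def)
  also have "(\<Union>\<sigma>\<in>UNIV. A \<inter> G \<sigma>) = A" by (auto simp: G_def)
  finally show "emeasure lborel (kick K h -` A) \<le> ennreal ((1 / ?c) ^ DIM(('d, 'n) phase)) * emeasure lborel A" .
qed

text \<open>A shear preserves volume, but the cruder factor from the perturbation estimate used for
  the kick is sufficient, as it is also exp(O(h)).\<close>

lemma emeasure_drift_vimage_le:
  fixes A :: "('d::finite, 'n::finite) phase set"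
  assumes h: "0 \<le> h" "h < 1" and A: "A \<in> sets borel"
  shows "drift h -` A \<in> sets borel"
    and "emeasure lborel (drift h -` A) \<le>
      ennreal ((1 / (1 - h)) ^ DIM(('d, 'n) phase)) * emeasure lborel A"
proof -
  let ?T = "drift h :: ('d, 'n) phase \<Rightarrow> ('d, 'n) phase"
  have lin: "linear ?T"
    by (rule linearI) (simp_all add: drift_def algebra_simps)
  have exp: "(1 - h) * norm z \<le> norm (?T z)" for z
  proof -
    let ?w = "(h *\<^sub>R snd z, 0) :: ('d, 'n) phase"
    have "norm ?w \<le> h * norm z"
      using h norm_snd_le[of "snd z" "fst z"] by (simp add: norm_Pair mult_left_mono)
    moreover have "?T z + - ?w = z" by (simp add: drift_def prod_eq_iff)
    then have "norm z \<le> norm (?T z) + norm ?w"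
      by (metis norm_minus_cancel norm_triangle_ineq)
    ultimately show ?thesis by (simp add: algebra_simps)
  qed
  have "continuous_on UNIV ?T" using lin by (simp add: linear_continuous_on linear_linear)
  from measurable_sets_borel[OF borel_measurable_continuous_onI[OF this] A]
  show "drift h -` A \<in> sets borel" by simp
  show "emeasure lborel (drift h -` A) \<le> ennreal ((1 / (1 - h)) ^ DIM(('d, 'n) phase)) * emeasure lborel A"
    using h by (intro emeasure_linear_vimage_le lin exp A) auto
qed

lemma emeasure_cs_step_vimage_le:
  fixes A :: "('d::finite, 'n::finite) phase set"
  assumes h: "0 \<le> h" "(2 * real CARD('n) * K 0 + 1) * h \<le> 1 / 2" and A: "A \<in> sets borel"
  shows "cs_step K h -` A \<in> sets borel"
    and "emeasure lborel (cs_step K h -` A) \<le>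
      ennreal (exp (4 * (2 * real CARD('n) * K 0 + 1) * h * DIM(('d, 'n) phase)))
      * emeasure lborel A"
proof -
  \<comment> \<open>\<open>?a\<close> dominates both the kick constant and the drift constant 1. The
    4 in the exponent is two substeps times the 2 from 1/(1-u) <= 1 + 2u <= exp(2u) for u <=
    1/2.\<close>
  let ?a = "2 * real CARD('n) * K 0 + 1"
  have inv: "1 / (1 - u) \<le> exp (2 * (?a * h))" if "0 \<le> u" "u \<le> ?a * h" for u
  proof -
    have u: "u \<le> 1 / 2" using that h by simp
    have "1 \<le> (1 - u) * (1 + 2 * u)" using that u mult_left_mono[OF u, of "2 * u"] by (simp add: algebra_simps)
    then have "1 / (1 - u) \<le> 1 + 2 * u" using u by (simp add: divide_le_eq mult.commute)
    also have "\<dots> \<le> exp (2 * u)" by (rule exp_ge_add_one_self)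
    also have "\<dots> \<le> exp (2 * (?a * h))" using that by simp
    finally show ?thesis .
  qed
  have nn: "0 \<le> 2 * real CARD('n) * K 0 * h" using h K0_pos by simp
  have c1: "2 * real CARD('n) * K 0 * h \<le> ?a * h" "h \<le> ?a * h"
    using h K0_pos nn by (simp_all add: algebra_simps)
  have h1: "2 * real CARD('n) * K 0 * h < 1" "h < 1" using c1 h by linarith+
  have eq: "cs_step K h -` A = kick K h -` (drift h -` A)" by (auto simp: cs_step_def)
  note D = emeasure_drift_vimage_le[OF h(1) h1(2) A]
  show "cs_step K h -` A \<in> sets borel"
    unfolding eq by (rule emeasure_kick_vimage_le(1)[OF h(1) h1(1) D(1)])
  have p: "ennreal ((1 / (1 - u)) ^ DIM(('d, 'n) phase)) \<le> ennreal (exp (2 * (?a * h)) ^ DIM(('d, 'n) phase))"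
    if "0 \<le> u" "u \<le> ?a * h" "u < 1" for u
    using that inv[of u] by (intro ennreal_leI power_mono) auto
  have "emeasure lborel (cs_step K h -` A) \<le>
      ennreal ((1 / (1 - 2 * real CARD('n) * K 0 * h)) ^ DIM(('d, 'n) phase)) * emeasure lborel (drift h -` A)"
    unfolding eq by (rule emeasure_kick_vimage_le(2)[OF h(1) h1(1) D(1)])
  also have "\<dots> \<le> ennreal (exp (2 * (?a * h)) ^ DIM(('d, 'n) phase)) * emeasure lborel (drift h -` A)"
    using h(1) h1 c1 nn by (intro mult_right_mono p) auto
  also have "\<dots> \<le> ennreal (exp (2 * (?a * h)) ^ DIM(('d, 'n) phase)) *
      (ennreal (exp (2 * (?a * h)) ^ DIM(('d, 'n) phase)) * emeasure lborel A)"
    using h h1 c1 by (intro mult_left_mono order_trans[OF D(2)] mult_right_mono p) auto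
  also have "\<dots> = ennreal (exp (2 * (?a * h)) ^ DIM(('d, 'n) phase) * exp (2 * (?a * h)) ^ DIM(('d, 'n) phase)) * emeasure lborel A"
    by (simp add: ennreal_mult mult.assoc)
  also have "exp (2 * (?a * h)) ^ DIM(('d, 'n) phase) * exp (2 * (?a * h)) ^ DIM(('d, 'n) phase) = exp (4 * ?a * h * DIM(('d, 'n) phase))"
    by (simp only: exp_of_nat_mult[symmetric] exp_add[symmetric]) (simp add: algebra_simps)
  finally show "emeasure lborel (cs_step K h -` A) \<le> ennreal (exp (4 * ?a * h * DIM(('d, 'n) phase))) * emeasure lborel A" .
qed

text \<open>At most t/h steps, each with a factor exp(O(h)), multiply to a factor that is
  independent of h.\<close>

lemma emeasure_cs_scheme_vimage_le:
  fixes A :: "('d::finite, 'n::finite) phase set"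
  assumes h: "0 < h" "(2 * real CARD('n) * K 0 + 1) * h \<le> 1 / 2" and A: "A \<in> sets borel" and t: "0 \<le> t"
  shows "cs_scheme K h t -` A \<in> sets borel"
    and "emeasure lborel (cs_scheme K h t -` A) \<le>
      ennreal (exp (4 * (2 * real CARD('n) * K 0 + 1) * DIM(('d, 'n) phase) * t))
      * emeasure lborel A"
proof -
  define c where "c = 4 * (2 * real CARD('n) * K 0 + 1) * DIM(('d, 'n) phase)"
  have c0: "0 \<le> c" using K0_pos by (simp add: c_def)
  have ce: "4 * (2 * real CARD('n) * K 0 + 1) * h * DIM(('d, 'n) phase) = c * h"
    by (simp add: c_def)
  have *: "(cs_step K h ^^ k) -` B \<in> sets borel \<and>
      emeasure lborel ((cs_step K h ^^ k) -` B) \<le> ennreal (exp (c * (real k * h))) * emeasure lborel B"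
    if "B \<in> sets borel" for k and B :: "('d, 'n) phase set"
    using that
  proof (induction k arbitrary: B)
    case (Suc k)
    note S = emeasure_cs_step_vimage_le[OF less_imp_le[OF h(1)] h(2) Suc.prems]
    note IH = Suc.IH[OF S(1)]
    have eq: "(cs_step K h ^^ Suc k) -` B = (cs_step K h ^^ k) -` (cs_step K h -` B)" by auto
    have "emeasure lborel ((cs_step K h ^^ Suc k) -` B) \<le>
        ennreal (exp (c * (real k * h))) * emeasure lborel (cs_step K h -` B)"
      unfolding eq using IH by blast
    also have "\<dots> \<le> ennreal (exp (c * (real k * h))) * (ennreal (exp (c * h)) * emeasure lborel B)"
      using S(2)[unfolded ce] by (intro mult_left_mono) simp_all
    also have "\<dots> = ennreal (exp (c * (real k * h)) * exp (c * h)) * emeasure lborel B"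
      by (simp add: ennreal_mult mult.assoc)
    also have "exp (c * (real k * h)) * exp (c * h) = exp (c * (real (Suc k) * h))"
      by (simp only: exp_add[symmetric] of_nat_Suc) (simp add: algebra_simps)
    finally have "emeasure lborel ((cs_step K h ^^ Suc k) -` B)
        \<le> ennreal (exp (c * (real (Suc k) * h))) * emeasure lborel B" .
    moreover have "(cs_step K h ^^ Suc k) -` B \<in> sets borel" unfolding eq using IH by blast
    ultimately show ?case by blast
  qed simp
  have eq: "cs_scheme K h t -` A = (cs_step K h ^^ nat \<lfloor>t / h\<rfloor>) -` A"
    by (auto simp: cs_scheme_def)
  show "cs_scheme K h t -` A \<in> sets borel" using *[OF A] by (simp add: eq)
  have "real (nat \<lfloor>t / h\<rfloor>) * h \<le> t"
  proof -
    have "0 \<le> t / h" using h(1) t by simp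
    then have "real (nat \<lfloor>t / h\<rfloor>) \<le> t / h" by linarith
    then show ?thesis using h(1) by (simp only: pos_le_divide_eq)
  qed
  then have "c * (real (nat \<lfloor>t / h\<rfloor>) * h) \<le> c * t" using c0 by (rule mult_left_mono)
  then have "ennreal (exp (c * (real (nat \<lfloor>t / h\<rfloor>) * h))) * emeasure lborel A \<le> ennreal (exp (c * t)) * emeasure lborel A"
    by (intro mult_right_mono) (auto intro: ennreal_leI)
  then have "emeasure lborel (cs_scheme K h t -` A) \<le> ennreal (exp (c * t)) * emeasure lborel A"
    unfolding eq by (rule order_trans[OF conjunct2[OF *[OF A]]])
  then show "emeasure lborel (cs_scheme K h t -` A) \<le>
      ennreal (exp (4 * (2 * real CARD('n) * K 0 + 1) * DIM(('d, 'n) phase) * t)) * emeasure lborel A"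
    by (simp only: c_def)
qed

end

section \<open>Ties\<close>

definition tie_gap :: "real ^ 'd ^ 'n \<Rightarrow> 'n \<Rightarrow> 'n \<Rightarrow> 'n \<Rightarrow> real" where
  "tie_gap x c i j = (x $ i - x $ j) \<bullet> (x $ i + x $ j - 2 *\<^sub>R x $ c)"

definition tie_rate :: "real ^ 'd ^ 'n \<Rightarrow> real ^ 'd ^ 'n \<Rightarrow> 'n \<Rightarrow> 'n \<Rightarrow> 'n \<Rightarrow> real" where
  "tie_rate x v c i j =
     (x $ i - x $ j) \<bullet> (v $ i + v $ j - 2 *\<^sub>R v $ c) + (v $ i - v $ j) \<bullet> (x $ i + x $ j - 2 *\<^sub>R x $ c)"

text \<open>Collisions of two agents are not excluded: they are ties seen from every third agent and
  are admissible when the tie function crosses zero with nonzero speed. This matters on a line,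
  where agents pass through one another. A triple collision is never transversal.\<close>

definition transversal :: "real ^ 'd ^ 'n \<Rightarrow> real ^ 'd ^ 'n \<Rightarrow> bool" where
  "transversal x v \<longleftrightarrow>
     (\<forall>c i j. distinct [c, i, j] \<longrightarrow> tie_gap x c i j \<noteq> 0 \<or> tie_rate x v c i j \<noteq> 0)"

definition tie_free :: "real ^ 'd ^ 'n \<Rightarrow> bool" where
  "tie_free x \<longleftrightarrow> (\<forall>c i j. distinct [c, i, j] \<longrightarrow> tie_gap x c i j \<noteq> 0)"

lemma tie_gap_eq: "tie_gap x c i j = (norm (x $ i - x $ c))\<^sup>2 - (norm (x $ j - x $ c))\<^sup>2"
  unfolding tie_gap_def power2_norm_eq_inner
  by (simp add: inner_diff_left inner_diff_right inner_add_right inner_commute algebra_simps)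

text \<open>The ranking is thus decided by signs of tie functions. As i and j always belong to the
  set, only triples of distinct agents have to be controlled.\<close>

lemma closer_eq_tie_gap: "closer x i j = {k. k = i \<or> k = j \<or> tie_gap x i k j \<le> 0}"
  by (auto simp: closer_def tie_gap_eq norm_minus_commute abs_le_square_iff[of "norm _" "norm _", simplified])

lemma closer_cong:
  assumes "\<And>k. distinct [i, k, j] \<Longrightarrow> tie_gap x i k j \<le> 0 \<longleftrightarrow> tie_gap y i k j \<le> 0" and "i \<noteq> j"
  shows "closer x i j = closer y i j"
proof -
  have "k = i \<or> k = j \<or> tie_gap x i k j \<le> 0 \<longleftrightarrow> k = i \<or> k = j \<or> tie_gap y i k j \<le> 0" for k
    using assms by (cases "k = i \<or> k = j") auto
  then show ?thesis by (simp add: closer_eq_tie_gap)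
qed

text \<open>The diagonal sets \<open>\<sigma> i i\<close> are irrelevant because they multiply \<open>v\<^sub>i - v\<^sub>i\<close>.\<close>

lemma ranked_field_cong:
  fixes v :: "real ^ 'd ^ 'n"
  assumes "\<And>j. j \<noteq> i \<Longrightarrow> \<sigma> i j = \<tau> i j"
  shows "ranked_field K \<sigma> v $ i = ranked_field K \<tau> v $ i"
proof -
  have "K (real (card (\<sigma> i j)) / real CARD('n)) *\<^sub>R (v $ j - v $ i)
      = K (real (card (\<tau> i j)) / real CARD('n)) *\<^sub>R (v $ j - v $ i)" for j
    using assms by (cases "j = i") auto
  then have "(\<Sum>j\<in>UNIV. K (real (card (\<sigma> i j)) / real CARD('n)) *\<^sub>R (v $ j - v $ i))
      = (\<Sum>j\<in>UNIV. K (real (card (\<tau> i j)) / real CARD('n)) *\<^sub>R (v $ j - v $ i))"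
    by (rule sum.cong[OF refl])
  then show ?thesis by (simp add: ranked_field_def)
qed

lemma tie_gap_has_derivative:
  fixes X :: "real \<Rightarrow> real ^ 'd ^ 'n"
  assumes "(X has_vector_derivative v) (at t within S)"
  shows "((\<lambda>t. tie_gap (X t) c i j) has_real_derivative tie_rate (X t) v c i j) (at t within S)"
proof -
  have comp: "((\<lambda>t. X t $ k) has_vector_derivative v $ k) (at t within S)" for k
    by (rule bounded_linear.has_vector_derivative[OF bounded_linear_vec_nth assms])
  have "((\<lambda>t. (X t $ i - X t $ j) \<bullet> (X t $ i + X t $ j - 2 *\<^sub>R X t $ c)) has_vector_derivative
      (X t $ i - X t $ j) \<bullet> (v $ i + v $ j - 2 *\<^sub>R v $ c) + (v $ i - v $ j) \<bullet> (X t $ i + X t $ j - 2 *\<^sub>R X t $ c))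
      (at t within S)"
    by (intro bounded_bilinear.has_vector_derivative[OF bounded_bilinear_inner]
        has_vector_derivative_diff has_vector_derivative_add comp
        bounded_linear.has_vector_derivative[OF bounded_linear_scaleR_right])
  then show ?thesis
    by (simp add: has_real_derivative_iff_has_vector_derivative tie_gap_def tie_rate_def)
qed

lemma continuous_tie_gap: "isCont (\<lambda>x :: real ^ 'd ^ 'n. tie_gap x c i j) x"
  unfolding tie_gap_def by (intro continuous_intros)

text \<open>The right-hand side involves only the value and the derivative at \<open>s\<close>, so
  two functions that share both have the same sign condition just after \<open>s\<close>.\<close>

lemma eventually_sign_at_right:
  fixes f :: "real \<Rightarrow> real"
  assumes der: "(f has_real_derivative d) (at s within {0..})" and s: "0 \<le> s"
    and nz: "f s \<noteq> 0 \<or> d \<noteq> 0"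
  shows "\<forall>\<^sub>F t in at_right s. f t \<le> 0 \<longleftrightarrow> f s < 0 \<or> (f s = 0 \<and> d < 0)"
proof (cases "f s = 0")
  case False
  have "(f \<longlongrightarrow> f s) (at s within {0..})"
    using DERIV_continuous[OF der] by (simp add: continuous_within)
  then have lim: "(f \<longlongrightarrow> f s) (at_right s)"
    by (rule tendsto_within_subset) (use s in auto)
  show ?thesis
  proof (cases "f s < 0")
    case True
    from order_tendstoD(2)[OF lim True] show ?thesis by eventually_elim (use True in auto)
  next
    case neg: False
    with False have "0 < f s" by simp
    from order_tendstoD(1)[OF lim this] show ?thesis by eventually_elim (use neg False in auto)
  qed
next
  case True
  with nz have "d < 0 \<or> 0 < d" by auto
  then show ?thesis
  proof
    assume d: "d < 0"
    obtain e where "e > 0" "\<And>h. 0 < h \<Longrightarrow> s + h \<in> {0..} \<Longrightarrow> h < e \<Longrightarrow> f (s + h) < f s"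
      using has_real_derivative_neg_dec_right[OF der d] by blast
    from this(1) this(2)[of "_ - s"] show ?thesis
      unfolding eventually_at_right_field using s True d
      by (intro exI[of _ "s + e"]) (force simp: less_imp_le)
  next
    assume d: "0 < d"
    obtain e where "e > 0" "\<And>h. 0 < h \<Longrightarrow> s + h \<in> {0..} \<Longrightarrow> h < e \<Longrightarrow> f s < f (s + h)"
      using has_real_derivative_pos_inc_right[OF der d] by blast
    from this(1) this(2)[of "_ - s"] show ?thesis
      unfolding eventually_at_right_field using s True d
      by (intro exI[of _ "s + e"]) (force simp: not_le)
  qed
qed

text \<open>The tie functions of the two curves share value and derivative at \<open>s\<close>,
  because the tie rate involves positions and velocities but not the force. No relation between the
  curves after \<open>s\<close> is assumed.\<close>

lemma eventually_closer_eq_at_right: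
  fixes X Y :: "real \<Rightarrow> real ^ 'd ^ 'n"
  assumes X: "(X has_vector_derivative v) (at s within {0..})"
    and Y: "(Y has_vector_derivative v) (at s within {0..})"
    and s: "0 \<le> s" and eq: "Y s = X s" and tr: "transversal (X s) v"
  shows "\<forall>\<^sub>F t in at_right s. \<forall>i j. i \<noteq> j \<longrightarrow> closer (X t) i j = closer (Y t) i j"
proof -
  have "\<forall>\<^sub>F t in at_right s. \<forall>c i j. distinct [c, i, j] \<longrightarrow>
      tie_gap (X t) c i j \<le> 0 \<longleftrightarrow> tie_gap (Y t) c i j \<le> 0"
  proof (intro eventually_all_finite)
    fix c i j :: 'n
    show "\<forall>\<^sub>F t in at_right s. distinct [c, i, j] \<longrightarrow>
      (tie_gap (X t) c i j \<le> 0 \<longleftrightarrow> tie_gap (Y t) c i j \<le> 0)"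
    proof (cases "distinct [c, i, j]")
      case True
      then have nz: "tie_gap (X s) c i j \<noteq> 0 \<or> tie_rate (X s) v c i j \<noteq> 0"
        using tr by (simp add: transversal_def)
      have "tie_gap (Y s) c i j \<noteq> 0 \<or> tie_rate (Y s) v c i j \<noteq> 0" using nz eq by simp
      from eventually_sign_at_right[OF tie_gap_has_derivative[OF X] s nz]
        eventually_sign_at_right[OF tie_gap_has_derivative[OF Y] s this]
      show ?thesis by eventually_elim (simp add: eq)
    next
      case False
      then show ?thesis by (intro always_eventually allI impI) blast
    qed
  qed
  then show ?thesis
  proof eventually_elim
    case (elim t)
    show ?case
    proof (intro allI impI)
      fix i j :: 'n assume "i \<noteq> j"
      then show "closer (X t) i j = closer (Y t) i j"
        using elim by (intro closer_cong) blast+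
    qed
  qed
qed

text \<open>Nonzero tie functions keep their signs under small perturbations, so near
  \<open>x\<close> the force is the field with the ranking of \<open>x\<close> frozen, which is
  linear and hence continuous.\<close>

lemma tendsto_force_field:
  fixes x v :: "real ^ 'd ^ 'n"
  assumes tf: "tie_free x" and y: "(y \<longlongrightarrow> x) F" and w: "(w \<longlongrightarrow> v) F"
  shows "((\<lambda>n. force_field K (y n) (w n)) \<longlongrightarrow> force_field K x v) F"
proof -
  have "\<forall>\<^sub>F n in F. \<forall>c i j. distinct [c, i, j] \<longrightarrow>
      tie_gap (y n) c i j \<le> 0 \<longleftrightarrow> tie_gap x c i j \<le> 0"
  proof (intro eventually_all_finite)
    fix c i j :: 'n
    have lim: "((\<lambda>n. tie_gap (y n) c i j) \<longlongrightarrow> tie_gap x c i j) F"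
      by (rule isCont_tendsto_compose[OF continuous_tie_gap y])
    show "\<forall>\<^sub>F n in F. distinct [c, i, j] \<longrightarrow> (tie_gap (y n) c i j \<le> 0 \<longleftrightarrow> tie_gap x c i j \<le> 0)"
    proof (cases "distinct [c, i, j]")
      case True
      with tf have "tie_gap x c i j < 0 \<or> tie_gap x c i j > 0" unfolding tie_free_def by (meson linorder_neqE_linordered_idom)
      then show ?thesis
      proof
        assume neg: "tie_gap x c i j < 0"
        from order_tendstoD(2)[OF lim neg] show ?thesis by eventually_elim (use neg in auto)
      next
        assume pos: "tie_gap x c i j > 0"
        from order_tendstoD(1)[OF lim pos] show ?thesis by eventually_elim (use pos in auto)
      qed
    next
      case False
      then show ?thesis by (intro always_eventually allI impI) blast
    qed
  qed
  then have "\<forall>\<^sub>F n in F. ranked_field K (closer x) (w n) = force_field K (y n) (w n)"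
  proof eventually_elim
    case (elim n)
    have "closer x i j = closer (y n) i j" if "i \<noteq> j" for i j
      using that elim by (intro closer_cong) blast+
    then have "ranked_field K (closer x) (w n) $ i = ranked_field K (closer (y n)) (w n) $ i" for i
      by (intro ranked_field_cong) auto
    then show ?case by (simp add: force_field_ranked vec_eq_iff)
  qed
  moreover have "((\<lambda>n. ranked_field K (closer x) (w n)) \<longlongrightarrow> ranked_field K (closer x) v) F"
    using linear_linear linear_ranked_field w bounded_linear.tendsto by blast
  ultimately show ?thesis
    by (simp add: force_field_ranked tendsto_cong)
qed

text \<open>A zero with nonvanishing derivative is isolated, and a compact interval contains only
  finitely many points of a set without accumulation points in it.\<close>

lemma finite_tie_times:
  fixes X V :: "real \<Rightarrow> real ^ 'd ^ 'n"
  assumes der: "\<And>t. 0 \<le> t \<Longrightarrow> (X has_vector_derivative V t) (at t within {0..})"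
    and tr: "\<And>t. 0 \<le> t \<Longrightarrow> transversal (X t) (V t)"
  shows "finite {t \<in> {0..T}. \<not> tie_free (X t)}"
proof -
  let ?Z = "\<lambda>c i j. {t \<in> {0..}. tie_gap (X t) c i j = 0}"
  have fin: "finite ({0..T} \<inter> ?Z c i j)" if d: "distinct [c, i, j]" for c i j
  proof (rule finite_not_islimpt_in_compact)
    fix z assume z: "z \<in> {0..T}"
    let ?f = "\<lambda>t. tie_gap (X t) c i j" and ?d = "tie_rate (X z) (V z) c i j"
    have f: "(?f has_real_derivative ?d) (at z within {0..})"
      using z by (intro tie_gap_has_derivative der) simp
    have nz: "?f z \<noteq> 0 \<or> ?d \<noteq> 0" using tr[of z] d z by (simp add: transversal_def)
    have "\<forall>\<^sub>F t in at z within {0..}. ?f t \<noteq> 0"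
    proof (cases "?f z = 0")
      case False
      have "(?f \<longlongrightarrow> ?f z) (at z within {0..})"
        using DERIV_continuous[OF f] by (simp add: continuous_within)
      then show ?thesis by (rule tendsto_imp_eventually_ne[OF _ False])
    next
      case True
      with nz have "?d \<noteq> 0" by simp
      moreover have "((\<lambda>t. (?f t - ?f z) / (t - z)) \<longlongrightarrow> ?d) (at z within {0..})"
        using f by (simp add: has_field_derivative_iff)
      ultimately have "\<forall>\<^sub>F t in at z within {0..}. (?f t - ?f z) / (t - z) \<noteq> 0"
        by (rule tendsto_imp_eventually_ne[rotated])
      then show ?thesis by eventually_elim (use True in auto)
    qed
    then obtain U where U: "open U" "z \<in> U" "\<And>t. t \<in> U \<Longrightarrow> t \<noteq> z \<Longrightarrow> t \<in> {0..} \<Longrightarrow> ?f t \<noteq> 0"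
      unfolding eventually_at_topological by blast
    then show "\<not> z islimpt ?Z c i j"
      unfolding islimpt_def by blast
  qed simp
  have "{t \<in> {0..T}. \<not> tie_free (X t)} \<subseteq>
      (\<Union>(c, i, j)\<in>{(c, i, j). distinct [c, i, j]}. {0..T} \<inter> ?Z c i j)"
  proof
    fix t assume t: "t \<in> {t \<in> {0..T}. \<not> tie_free (X t)}"
    then obtain c i j where "distinct [c, i, j]" "tie_gap (X t) c i j = 0"
      unfolding tie_free_def by blast
    with t show "t \<in> (\<Union>(c, i, j)\<in>{(c, i, j). distinct [c, i, j]}. {0..T} \<inter> ?Z c i j)"
      by (intro UN_I[of "(c, i, j)"]) auto
  qed
  moreover have "finite \<dots>" using fin by (intro finite_UN_I) auto
  ultimately show ?thesis by (rule finite_subset)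
qed

section \<open>Limits of the scheme\<close>

lemma has_integral_floor_step:
  fixes f :: "nat \<Rightarrow> 'a::banach"
  assumes h: "0 < h" and t: "0 \<le> t"
  defines "k \<equiv> nat \<lfloor>t / h\<rfloor>"
  shows "((\<lambda>s. f (nat \<lfloor>s / h\<rfloor>)) has_integral
      h *\<^sub>R (\<Sum>l<k. f l) + (t - real k * h) *\<^sub>R f k) {0..t}"
proof -
  have piece: "((\<lambda>s. f (nat \<lfloor>s / h\<rfloor>)) has_integral (b - real k * h) *\<^sub>R f k) {real k * h..b}"
    if b: "real k * h \<le> b" "b \<le> real (Suc k) * h" for k b
  \<comment> \<open>At the right end b = (k+1)h the floor has already jumped to the next
    value.\<close>
  proof (rule has_integral_spike_finite[of "{b}"])
    show "((\<lambda>s. f k) has_integral (b - real k * h) *\<^sub>R f k) {real k * h..b}"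
      using has_integral_const_real[of "f k" "real k * h" b] b by simp
    fix s assume s: "s \<in> {real k * h..b} - {b}"
    then have "real k \<le> s / h" using h by (simp add: pos_le_divide_eq)
    moreover have "s < real (Suc k) * h" using s b by auto
    then have "s / h < real (Suc k)" using h by (simp only: pos_divide_less_eq)
    then have "s / h < real k + 1" by simp
    ultimately have "\<lfloor>s / h\<rfloor> = int k" by linarith
    then show "f (nat \<lfloor>s / h\<rfloor>) = f k" by simp
  qed simp
  have full: "((\<lambda>s. f (nat \<lfloor>s / h\<rfloor>)) has_integral h *\<^sub>R (\<Sum>l<k. f l)) {0..real k * h}" for k
  proof (induction k)
    case (Suc k)
    have 1: "((\<lambda>s. f (nat \<lfloor>s / h\<rfloor>)) has_integral h *\<^sub>R f k) {real k * h..real (Suc k) * h}"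
    proof -
      have "real (Suc k) * h - real k * h = h" by (simp add: algebra_simps)
      with piece[of k "real (Suc k) * h"] h show ?thesis by (simp add: mult_right_mono)
    qed
    have "((\<lambda>s. f (nat \<lfloor>s / h\<rfloor>)) has_integral (h *\<^sub>R (\<Sum>l<k. f l) + h *\<^sub>R f k)) {0..real (Suc k) * h}"
      by (rule has_integral_combine[OF _ _ Suc 1]) (use h in auto)
    then show ?case by (simp only: sum.lessThan_Suc scaleR_add_right)
  qed (simp add: has_integral_refl)
  have k: "real k * h \<le> t" "t \<le> real (Suc k) * h"
  proof -
    have "0 \<le> t / h" using h t by simp
    then have "real k \<le> t / h" "t / h \<le> real (Suc k)" unfolding k_def of_nat_Suc by linarith+
    then show "real k * h \<le> t" "t \<le> real (Suc k) * h"
      using h by (simp_all only: pos_le_divide_eq pos_divide_le_eq)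
  qed
  show ?thesis
    by (rule has_integral_combine[OF _ k(1) full piece[OF k]]) (use h in auto)
qed

text \<open>Turns a limit of discrete sums into an integral equation: the sum is the integral of a
  step function up to the last incomplete cell, which contributes at most \<open>h n * B\<close>.
  The set \<open>S\<close> is meant for tie times, where the discrete forces need not
  converge.\<close>

lemma has_integral_floor_step_limit:
  fixes f :: "nat \<Rightarrow> nat \<Rightarrow> 'a::euclidean_space"
  assumes h: "\<And>n. 0 < h n" "h \<longlonglongrightarrow> 0" and t: "0 \<le> t"
    and B: "\<And>n l. norm (f n l) \<le> B" and S: "finite S"
    and lim: "\<And>s. s \<in> {0..t} - S \<Longrightarrow> (\<lambda>n. f n (nat \<lfloor>s / h n\<rfloor>)) \<longlonglongrightarrow> g s"
    and I: "(\<lambda>n. h n *\<^sub>R (\<Sum>l<nat \<lfloor>t / h n\<rfloor>. f n l)) \<longlonglongrightarrow> I"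
  shows "(g has_integral I) {0..t}"
proof -
  have B0: "0 \<le> B" using B[of 0 0] norm_ge_zero order_trans by blast
  define J where "J n = h n *\<^sub>R (\<Sum>l<nat \<lfloor>t / h n\<rfloor>. f n l)
      + (t - real (nat \<lfloor>t / h n\<rfloor>) * h n) *\<^sub>R f n (nat \<lfloor>t / h n\<rfloor>)" for n
  \<comment> \<open>Both sides are reset to 0 on \<open>S\<close> because dominated convergence is
    applied in a form asking for convergence at every point; the integrals do not change.\<close>
  define F where "F n s = (if s \<in> S then 0 else f n (nat \<lfloor>s / h n\<rfloor>))" for n s
  define G where "G s = (if s \<in> S then 0 else g s)" for s
  have F: "(F n has_integral J n) {0..t}" for n
    by (rule has_integral_spike_finite[OF S _ has_integral_floor_step[OF h(1)[of n] t, of "f n", folded J_def]])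
      (simp add: F_def)
  have err: "norm ((t - real (nat \<lfloor>t / h n\<rfloor>) * h n) *\<^sub>R f n (nat \<lfloor>t / h n\<rfloor>)) \<le> h n * B" for n
  proof -
    have "0 \<le> t / h n" using h(1)[of n] t by simp
    then have "real (nat \<lfloor>t / h n\<rfloor>) \<le> t / h n" "t / h n \<le> real (nat \<lfloor>t / h n\<rfloor>) + 1"
      by linarith+
    then have "0 \<le> t - real (nat \<lfloor>t / h n\<rfloor>) * h n" "t - real (nat \<lfloor>t / h n\<rfloor>) * h n \<le> h n"
      using h(1)[of n] by (simp_all add: pos_le_divide_eq pos_divide_le_eq algebra_simps)
    then show ?thesis using B[of n] h(1)[of n] by (auto intro!: mult_mono)
  qed
  have "(\<lambda>n. (t - real (nat \<lfloor>t / h n\<rfloor>) * h n) *\<^sub>R f n (nat \<lfloor>t / h n\<rfloor>)) \<longlonglongrightarrow> 0"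
  proof (rule Lim_null_comparison)
    show "(\<lambda>n. h n * B) \<longlonglongrightarrow> 0" using tendsto_mult_left_zero[OF h(2)] by simp
  qed (intro always_eventually allI err)
  from tendsto_add[OF I this] have J: "J \<longlonglongrightarrow> I" by (simp add: J_def[abs_def])
  have conv: "(\<lambda>n. F n s) \<longlonglongrightarrow> G s" if "s \<in> {0..t}" for s
    using lim[of s] that by (simp add: F_def G_def)
  have le: "norm (F n s) \<le> B" for n s using B B0 by (simp add: F_def)
  have "(\<lambda>s::real. B) integrable_on {0..t}" by (rule integrable_const_ivl)
  note dc = dominated_convergence[of F "{0..t}", OF has_integral_integrable[OF F] this le conv]
  have "(\<lambda>n. integral {0..t} (F n)) = J" using F by (auto simp: integral_unique)
  with dc(2) J have "integral {0..t} G = I" by (simp add: LIMSEQ_unique)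
  with dc(1) have "(G has_integral I) {0..t}" by (simp add: has_integral_iff)
  then show ?thesis
    by (rule has_integral_spike_finite[OF S, rotated]) (simp add: G_def)
qed

lemma norm_le_card_mult:
  fixes v :: "real ^ 'd ^ 'n"
  assumes "\<And>i. norm (v $ i) \<le> R"
  shows "norm v \<le> real CARD('n) * R"
proof -
  have "norm v \<le> (\<Sum>i\<in>UNIV. norm (v $ i))"
    unfolding norm_vec_def by (rule L2_set_le_sum) simp
  also have "\<dots> \<le> (\<Sum>i\<in>(UNIV::'n set). R)" by (intro sum_mono assms)
  finally show ?thesis by simp
qed

context cs_kernel
begin

text \<open>The index is shifted by one because the drift uses the velocity after the kick.\<close>

lemma cs_iterate_fst:
  fixes x v :: "real ^ 'a ^ 'b"
  shows
  "fst ((cs_step K h ^^ k) (x, v)) = x + h *\<^sub>R (\<Sum>l<k. snd ((cs_step K h ^^ Suc l) (x, v)))"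
proof (induction k)
  case (Suc k)
  have "fst (cs_step K h z) = fst z + h *\<^sub>R snd (cs_step K h z)" for z :: "('a, 'b) phase"
    by (simp add: cs_step_def drift_def kick_def)
  with Suc show ?case by (simp add: scaleR_add_right)
qed simp

lemma cs_iterate_snd:
  fixes x v :: "real ^ 'a ^ 'b"
  shows
  "snd ((cs_step K h ^^ k) (x, v)) = v + h *\<^sub>R (\<Sum>l<k.
     force_field K (fst ((cs_step K h ^^ l) (x, v))) (snd ((cs_step K h ^^ l) (x, v))))"
proof (induction k)
  case (Suc k)
  have "snd (cs_step K h z) = snd z + h *\<^sub>R force_field K (fst z) (snd z)" for z :: "('a, 'b) phase"
    by (simp add: cs_step_def drift_def kick_def)
  with Suc show ?case by (simp add: scaleR_add_right)
qed simp

end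

text \<open>Pointwise convergence is enough: continuity of the limit comes from increment bounds
  that are uniform in n up to an error \<open>h n\<close>.\<close>

locale cs_scheme_limit = cs_kernel K for K +
  fixes h :: "nat \<Rightarrow> real" and x v :: "real ^ 'd ^ 'n" and X V :: "real \<Rightarrow> real ^ 'd ^ 'n"
  assumes h_pos: "\<And>n. 0 < h n" and h_small: "\<And>n. h n * K 0 \<le> 1" and h_lim: "h \<longlonglongrightarrow> 0"
    and lim: "\<And>t. 0 \<le> t \<Longrightarrow> (\<lambda>n. cs_scheme K (h n) t (x, v)) \<longlonglongrightarrow> (X t, V t)"
begin

lemma lim_fst: "0 \<le> t \<Longrightarrow> (\<lambda>n. fst (cs_scheme K (h n) t (x, v))) \<longlonglongrightarrow> X t"
  using tendsto_fst[OF lim] by simp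

lemma lim_snd: "0 \<le> t \<Longrightarrow> (\<lambda>n. snd (cs_scheme K (h n) t (x, v))) \<longlonglongrightarrow> V t"
  using tendsto_snd[OF lim] by simp

lemma initial: "X 0 = x" "V 0 = v"
proof -
  have "(X 0, V 0) = (x, v)"
    using lim[of 0] by (simp add: cs_scheme_def LIMSEQ_const_iff)
  then show "X 0 = x" "V 0 = v" by simp_all
qed

lemma norm_V_le:
  assumes "\<And>j. norm (v $ j) \<le> R" and t: "0 \<le> t"
  shows "norm (V t $ i) \<le> R"
proof -
  have "(\<lambda>n. norm (snd (cs_scheme K (h n) t (x, v)) $ i)) \<longlonglongrightarrow> norm (V t $ i)"
    by (intro tendsto_norm tendsto_vec_nth lim_snd t)
  moreover have "norm (snd (cs_scheme K (h n) t (x, v)) $ i) \<le> R" for n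
    by (rule cs_scheme_bounds(1)[OF h_pos h_small t Finite_Cartesian_Product.norm_nth_le assms(1)])
  ultimately show ?thesis by (intro LIMSEQ_le_const2) auto
qed

lemma norm_X_le:
  assumes "\<And>j. norm (x $ j) \<le> Rx" "\<And>j. norm (v $ j) \<le> R" and t: "0 \<le> t"
  shows "norm (X t $ i) \<le> Rx + t * R"
proof -
  have "(\<lambda>n. norm (fst (cs_scheme K (h n) t (x, v)) $ i)) \<longlonglongrightarrow> norm (X t $ i)"
    by (intro tendsto_norm tendsto_vec_nth lim_fst t)
  moreover have "norm (fst (cs_scheme K (h n) t (x, v)) $ i) \<le> Rx + t * R" for n
    by (rule cs_scheme_bounds(2)[OF h_pos h_small t assms(1,2)])
  ultimately show ?thesis by (intro LIMSEQ_le_const2) auto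
qed

lemma V_increment_le:
  assumes R: "\<And>j. norm (v $ j) \<le> R" and t: "0 \<le> s" "s \<le> t"
  shows "norm (V t $ i - V s $ i) \<le> 2 * K 0 * R * (t - s)"
proof (rule LIMSEQ_le)
  show "(\<lambda>n. norm (snd (cs_scheme K (h n) t (x, v)) $ i - snd (cs_scheme K (h n) s (x, v)) $ i))
      \<longlonglongrightarrow> norm (V t $ i - V s $ i)"
    using t by (intro tendsto_norm tendsto_diff tendsto_vec_nth lim_snd) auto
  show "(\<lambda>n. 2 * K 0 * R * (t - s + h n)) \<longlonglongrightarrow> 2 * K 0 * R * (t - s)"
    by (rule tendsto_eq_intros refl h_lim)+ simp
qed (intro exI allI impI cs_scheme_increment_le(1)[OF h_pos h_small t R])

lemma X_increment_le:
  assumes R: "\<And>j. norm (v $ j) \<le> R" and t: "0 \<le> s" "s \<le> t"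
  shows "norm (X t $ i - X s $ i) \<le> R * (t - s)"
proof (rule LIMSEQ_le)
  show "(\<lambda>n. norm (fst (cs_scheme K (h n) t (x, v)) $ i - fst (cs_scheme K (h n) s (x, v)) $ i))
      \<longlonglongrightarrow> norm (X t $ i - X s $ i)"
    using t by (intro tendsto_norm tendsto_diff tendsto_vec_nth lim_fst) auto
  show "(\<lambda>n. R * (t - s + h n)) \<longlonglongrightarrow> R * (t - s)"
    by (rule tendsto_eq_intros refl h_lim)+ simp
qed (intro exI allI impI cs_scheme_increment_le(2)[OF h_pos h_small t R])

lemma V_lipschitz:
  assumes R: "\<And>j. norm (v $ j) \<le> R"
  shows "(2 * R * K 0)-lipschitz_on {0..} (\<lambda>t. V t $ i)"
proof (rule lipschitz_onI)
  show "0 \<le> 2 * R * K 0" using R[of i] norm_ge_zero[of "v $ i"] K0_pos by (intro mult_nonneg_nonneg) linarith+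
  fix s t :: real assume st: "s \<in> {0..}" "t \<in> {0..}"
  show "dist (V s $ i) (V t $ i) \<le> 2 * R * K 0 * dist s t"
  proof (cases "s \<le> t")
    case True
    with V_increment_le[OF R, of s t i] st show ?thesis
      by (simp add: dist_norm norm_minus_commute[of "V s $ i"] algebra_simps)
  next
    case False
    with V_increment_le[OF R, of t s i] st show ?thesis
      by (simp add: dist_norm algebra_simps)
  qed
qed

lemma continuous_V: "continuous_on {0..} V"
proof -
  have "continuous_on {0..} (\<lambda>t. V t $ i)" for i
    by (rule lipschitz_on_continuous_on[OF V_lipschitz[OF Finite_Cartesian_Product.norm_nth_le]])
  then have "continuous_on {0..} (\<lambda>t. \<chi> i. V t $ i)" by (rule continuous_on_vec_lambda)
  then show ?thesis by simp
qed

lemma iterate_bounds: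
  "norm (snd ((cs_step K (h n) ^^ k) (x, v))) \<le> real CARD('n) * norm v"
  "norm (snd ((cs_step K (h n) ^^ Suc k) (x, v)) $ i - snd ((cs_step K (h n) ^^ k) (x, v)) $ i)
     \<le> 2 * K 0 * norm v * h n"
proof -
  note vj = Finite_Cartesian_Product.norm_nth_le[of v]
  show "norm (snd ((cs_step K (h n) ^^ k) (x, v))) \<le> real CARD('n) * norm v"
    by (rule norm_le_card_mult)
      (rule cs_iterate_bounds(1)[OF less_imp_le[OF h_pos] h_small Finite_Cartesian_Product.norm_nth_le vj])
  show "norm (snd ((cs_step K (h n) ^^ Suc k) (x, v)) $ i - snd ((cs_step K (h n) ^^ k) (x, v)) $ i)
     \<le> 2 * K 0 * norm v * h n"
    using cs_iterate_increment_le(1)[OF less_imp_le[OF h_pos] h_small vj, of k "Suc k" n x i]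
    by (simp only: le_SucI order_refl) (simp add: algebra_simps)
qed

lemma velocity_has_integral:
  assumes t: "0 \<le> t"
  shows "(V has_integral (X t - x)) {0..t}"
proof (rule has_integral_floor_step_limit[OF h_pos h_lim t _ finite.emptyI])
  let ?z = "\<lambda>n k. (cs_step K (h n) ^^ k) (x, v)"
  show "norm (snd (?z n (Suc l))) \<le> real CARD('n) * norm v" for n l by (rule iterate_bounds(1))
  fix s :: real assume s: "s \<in> {0..t} - {}"
  show "(\<lambda>n. snd (?z n (Suc (nat \<lfloor>s / h n\<rfloor>)))) \<longlonglongrightarrow> V s"
  proof (rule vec_tendstoI)
    fix i
    \<comment> \<open>One step changes velocities by O(h), so the index shift in the position sums
      disappears in the limit.\<close>
    have "(\<lambda>n. snd (?z n (Suc (nat \<lfloor>s / h n\<rfloor>))) $ i - snd (?z n (nat \<lfloor>s / h n\<rfloor>)) $ i) \<longlonglongrightarrow> 0"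
    proof (rule Lim_null_comparison)
      show "(\<lambda>n. 2 * K 0 * norm v * h n) \<longlonglongrightarrow> 0" using tendsto_mult_right_zero[OF h_lim] by simp
    qed (intro always_eventually allI iterate_bounds(2))
    moreover have "(\<lambda>n. snd (?z n (nat \<lfloor>s / h n\<rfloor>)) $ i) \<longlonglongrightarrow> V s $ i"
      using tendsto_vec_nth[OF lim_snd[of s]] s by (simp add: cs_scheme_def)
    ultimately show "(\<lambda>n. snd (?z n (Suc (nat \<lfloor>s / h n\<rfloor>))) $ i) \<longlonglongrightarrow> V s $ i"
      using tendsto_add by fastforce
  qed
next
  have "(\<lambda>n. fst (cs_scheme K (h n) t (x, v)) - x) \<longlonglongrightarrow> X t - x"
    by (intro tendsto_diff lim_fst t tendsto_const)
  then show "(\<lambda>n. h n *\<^sub>R (\<Sum>l<nat \<lfloor>t / h n\<rfloor>. snd ((cs_step K (h n) ^^ Suc l) (x, v)))) \<longlonglongrightarrow> X t - x"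
    by (subst (asm) cs_scheme_def, subst (asm) cs_iterate_fst) simp
qed

lemma X_has_vector_derivative:
  assumes t: "0 \<le> t"
  shows "(X has_vector_derivative V t) (at t within {0..})"
proof -
  have "((\<lambda>u. integral {0..u} V) has_vector_derivative V t) (at t within {0..t + 1})"
    by (rule integral_has_vector_derivative[OF continuous_on_subset[OF continuous_V]]) (use t in auto)
  then have "((\<lambda>u. x + integral {0..u} V) has_vector_derivative V t) (at t within {0..t + 1})"
    using has_vector_derivative_add[OF has_vector_derivative_const] by fastforce
  then have "(X has_vector_derivative V t) (at t within {0..t + 1})"
    by (rule has_vector_derivative_transform[rotated 2])
      (use t in \<open>auto simp: integral_unique[OF velocity_has_integral]\<close>)
  moreover have "at t within {0..t + 1} = at t within {0..}"
    by (rule at_within_nhd[of _ "{..<t + 1}"]) (use t in auto)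
  ultimately show ?thesis by simp
qed

text \<open>The discrete forces converge wherever the limit positions are tie-free, and the finitely
  many other times are absorbed by the exceptional set of the limit lemma.\<close>

lemma force_has_integral:
  assumes t: "0 \<le> t" and fin: "finite {s \<in> {0..t}. \<not> tie_free (X s)}"
  shows "((\<lambda>s. force_field K (X s) (V s)) has_integral (V t - v)) {0..t}"
proof (rule has_integral_floor_step_limit[OF h_pos h_lim t _ fin])
  let ?z = "\<lambda>n k. (cs_step K (h n) ^^ k) (x, v)"
  let ?F = "\<lambda>z. force_field K (fst z) (snd z)"
  show "norm (?F (?z n l)) \<le> 2 * real CARD('n) * K 0 * (real CARD('n) * norm v)" for n l
    unfolding force_field_ranked
    by (rule order_trans[OF norm_ranked_field_le mult_left_mono[OF iterate_bounds(1)]])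
      (use K0_pos in auto)
  fix s :: real assume s: "s \<in> {0..t} - {s \<in> {0..t}. \<not> tie_free (X s)}"
  then have "(\<lambda>n. ?F (cs_scheme K (h n) s (x, v))) \<longlonglongrightarrow> force_field K (X s) (V s)"
    by (intro tendsto_force_field lim_fst lim_snd) auto
  then show "(\<lambda>n. ?F (?z n (nat \<lfloor>s / h n\<rfloor>))) \<longlonglongrightarrow> force_field K (X s) (V s)"
    by (simp add: cs_scheme_def)
next
  have "(\<lambda>n. snd (cs_scheme K (h n) t (x, v)) - v) \<longlonglongrightarrow> V t - v"
    by (intro tendsto_diff lim_snd t tendsto_const)
  then show "(\<lambda>n. h n *\<^sub>R (\<Sum>l<nat \<lfloor>t / h n\<rfloor>. force_field K (fst ((cs_step K (h n) ^^ l) (x, v)))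
      (snd ((cs_step K (h n) ^^ l) (x, v))))) \<longlonglongrightarrow> V t - v"
    by (subst (asm) cs_scheme_def, subst (asm) cs_iterate_snd) simp
qed

lemma is_solution:
  assumes tr: "\<And>t. 0 \<le> t \<Longrightarrow> transversal (X t) (V t)"
  shows "topological_CS_solution K x v X V"
proof -
  have "((\<lambda>s. alignment_force K (X s) (V s) i) has_integral (V t $ i - v $ i)) {0..t}" if "0 \<le> t" for i t
    using has_integral_linear[OF force_has_integral[OF that finite_tie_times[OF X_has_vector_derivative tr]]
        bounded_linear_vec_nth[of i]]
    by (simp add: o_def force_field_def)
  then show ?thesis
    unfolding topological_CS_solution_def
    using initial continuous_V X_has_vector_derivative by (auto simp: has_integral_iff)
qed

end

section \<open>Uniqueness\<close>

lemma solutionD: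
  assumes "topological_CS_solution K x v X V"
  shows "X 0 = x" "V 0 = v" "continuous_on {0..} V"
    and "0 \<le> t \<Longrightarrow> (X has_vector_derivative V t) (at t within {0..})"
proof -
  note * = assms[unfolded topological_CS_solution_def]
  show "X 0 = x" by (rule conjunct1[OF *])
  show "V 0 = v" by (rule conjunct1[OF conjunct2[OF *]])
  show "continuous_on {0..} V" by (rule conjunct1[OF conjunct2[OF conjunct2[OF *]]])
  show "(X has_vector_derivative V t) (at t within {0..})" if "0 \<le> t"
    using conjunct1[OF conjunct2[OF conjunct2[OF conjunct2[OF *]]]] that by blast
qed

lemma solution_velocity_increment:
  assumes sol: "topological_CS_solution K x v X V" and st: "0 \<le> s" "s \<le> t"
  shows "((\<lambda>r. alignment_force K (X r) (V r) i) has_integral (V t $ i - V s $ i)) {s..t}"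
proof -
  let ?f = "\<lambda>r. alignment_force K (X r) (V r) i"
  have int: "?f integrable_on {0..t}" and Vt: "V t $ i = V 0 $ i + integral {0..t} ?f"
    and Vs: "V s $ i = V 0 $ i + integral {0..s} ?f"
    using sol st unfolding topological_CS_solution_def by (meson order_trans)+
  have "integral {0..s} ?f + integral {s..t} ?f = integral {0..t} ?f"
    by (rule Henstock_Kurzweil_Integration.integral_combine[OF st int])
  moreover have "?f integrable_on {s..t}"
    by (rule integrable_on_subinterval[OF int]) (use st in auto)
  ultimately show ?thesis using Vt Vs by (simp add: has_integral_iff algebra_simps)
qed

lemma continuous_on_has_vector_derivative:
  assumes "\<And>t. t \<in> S \<Longrightarrow> (f has_vector_derivative f' t) (at t within S)"
  shows "continuous_on S f"
  unfolding continuous_on_eq_continuous_within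
proof
  fix t assume "t \<in> S"
  from assms[OF this] show "continuous (at t within S) f" by (rule has_vector_derivative_continuous)
qed

context cs_kernel
begin

text \<open>Just after \<open>s\<close> both solutions have the same ranking, so the difference
  \<open>?W\<close> of the velocities obeys a linear equation in which positions no longer appear.
  On a short interval its maximum is at most half of itself, hence zero; then the positions differ
  by a constant, which vanishes at \<open>s\<close>.\<close>

lemma local_uniqueness:
  fixes X V X' V' :: "real \<Rightarrow> real ^ 'd ^ 'n"
  assumes sol: "topological_CS_solution K x v X V" and sol': "topological_CS_solution K x v X' V'"
    and s: "0 \<le> s" and eq: "X' s = X s" "V' s = V s" and tr: "transversal (X s) (V s)"
  obtains e where "0 < e" "\<And>t. s \<le> t \<Longrightarrow> t \<le> s + e \<Longrightarrow> X' t = X t \<and> V' t = V t"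
proof -
  let ?W = "\<lambda>t. V t - V' t"
  have "(X has_vector_derivative V s) (at s within {0..})" "(X' has_vector_derivative V s) (at s within {0..})"
    using solutionD(4)[OF sol s] solutionD(4)[OF sol' s] eq by auto
  from eventually_closer_eq_at_right[OF this s eq(1) tr]
  obtain b where b: "s < b" "\<And>t i j. s < t \<Longrightarrow> t < b \<Longrightarrow> i \<noteq> j \<Longrightarrow> closer (X t) i j = closer (X' t) i j"
    unfolding eventually_at_right_field by blast
  \<comment> \<open>\<open>c\<close> is the componentwise bound 2 K(0) times the number of
    components; \<open>e\<close> makes c e at most 1/2 and stays strictly inside the interval of
    common ranking.\<close>
  define c where "c = 2 * K 0 * real CARD('n)"
  have c: "c > 0" using K0_pos by (simp add: c_def)
  define e where "e = min ((b - s) / 2) (1 / (2 * c))"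
  have e: "0 < e" "s + e < b" "c * e \<le> 1 / 2"
    using b(1) c unfolding e_def by (auto simp: min_def field_simps)
  have contW: "continuous_on {0..} ?W"
    using solutionD(3)[OF sol] solutionD(3)[OF sol'] by (intro continuous_on_diff)
  then have contN: "continuous_on {s..s + e} (\<lambda>t. norm (?W t))"
    using s by (intro continuous_on_norm continuous_on_subset[OF contW]) auto
  obtain m where m: "m \<in> {s..s + e}" "\<And>t. t \<in> {s..s + e} \<Longrightarrow> norm (?W t) \<le> norm (?W m)"
    using continuous_attains_sup[OF _ _ contN] e(1) by force
  have "norm (?W m $ i) \<le> 2 * K 0 * norm (?W m) * e" for i
  proof -
    let ?F = "\<lambda>r. alignment_force K (X r) (V r) i - alignment_force K (X' r) (V' r) i"
    have "(?F has_integral (V m $ i - V s $ i) - (V' m $ i - V' s $ i)) {s..m}"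
      using m(1) s by (intro has_integral_diff solution_velocity_increment[OF sol]
          solution_velocity_increment[OF sol']) auto
    then have int: "(?F has_integral ?W m $ i) {s..m}" by (simp add: eq)
    have bound: "norm (?F r) \<le> 2 * K 0 * norm (?W m)" if r: "r \<in> {s..m} - {s}" for r
    proof -
      have "closer (X r) i j = closer (X' r) i j" if "j \<noteq> i" for j
        using b(2)[of r i j] r m(1) e(2) that by auto
      then have "ranked_field K (closer (X' r)) (V' r) $ i = ranked_field K (closer (X r)) (V' r) $ i"
        by (intro ranked_field_cong) auto
      then have "?F r = (ranked_field K (closer (X r)) (V r) - ranked_field K (closer (X r)) (V' r)) $ i"
        unfolding force_field_ranked[symmetric] by (simp add: force_field_def)
      also have "\<dots> = ranked_field K (closer (X r)) (?W r) $ i"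
        by (simp add: linear_diff[OF linear_ranked_field])
      finally have "norm (?F r) \<le> 2 * K 0 * norm (?W r)"
        by (simp only: norm_ranked_component_le[OF Finite_Cartesian_Product.norm_nth_le])
      also have "\<dots> \<le> 2 * K 0 * norm (?W m)"
        using m r K0_pos by (intro mult_left_mono) auto
      finally show ?thesis .
    qed
    have "norm (?W m $ i) \<le> 2 * K 0 * norm (?W m) * measure lborel (cbox s m)"
      by (rule has_integral_bound_spike_finite[of _ "{s}" ?F])
        (use int bound K0_pos in auto)
    also have "\<dots> \<le> 2 * K 0 * norm (?W m) * e"
      using m(1) K0_pos by (intro mult_left_mono) auto
    finally show ?thesis .
  qed
  then have "norm (?W m) \<le> real CARD('n) * (2 * K 0 * norm (?W m) * e)" by (rule norm_le_card_mult)
  also have "\<dots> = (c * e) * norm (?W m)" by (simp add: c_def)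
  also have "\<dots> \<le> 1 / 2 * norm (?W m)" using e(3) by (intro mult_right_mono) auto
  finally have "norm (?W m) = 0" using norm_ge_zero[of "?W m"] by linarith
  then have W: "V' t = V t" if "t \<in> {s..s + e}" for t
    using m(2)[OF that] by simp
  have "((\<lambda>t. X t - X' t) has_vector_derivative 0) (at t within {s..s + e})" if t: "t \<in> {s..s + e}" for t
  proof -
    have "((\<lambda>t. X t - X' t) has_vector_derivative V t - V' t) (at t within {0..})"
      using s t by (intro has_vector_derivative_diff solutionD(4)[OF sol] solutionD(4)[OF sol']) auto
    then have "((\<lambda>t. X t - X' t) has_vector_derivative V t - V' t) (at t within {s..s + e})"
      by (rule has_vector_derivative_within_subset) (use s in auto)
    then show ?thesis using W[OF t] by simp
  qed
  from has_vector_derivative_zero_constant[OF convex_real_interval(5) this]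
  obtain d where "\<And>t. t \<in> {s..s + e} \<Longrightarrow> X t - X' t = d" by blast
  moreover from this[of s] have "d = 0" using eq e(1) by simp
  ultimately have "X' t = X t" if "t \<in> {s..s + e}" for t using that by force
  with W e(1) show thesis by (intro that[of e]) auto
qed

text \<open>The set of agreement is closed, so the solutions still agree at the infimum of the times
  of disagreement, where local uniqueness carries them further.\<close>

lemma uniqueness:
  fixes X V X' V' :: "real \<Rightarrow> real ^ 'd ^ 'n"
  assumes sol: "topological_CS_solution K x v X V" and sol': "topological_CS_solution K x v X' V'"
    and tr: "\<And>t. 0 \<le> t \<Longrightarrow> transversal (X t) (V t)" and t: "0 \<le> t"
  shows "X' t = X t \<and> V' t = V t"
proof (rule ccontr)
  let ?D = "{t \<in> {0..}. \<not> (X' t = X t \<and> V' t = V t)}"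
  assume "\<not> (X' t = X t \<and> V' t = V t)"
  with t have ne: "?D \<noteq> {}" by auto
  have bdd: "bdd_below ?D" by (rule bdd_belowI[of _ 0]) auto
  define s where "s = Inf ?D"
  have s: "0 \<le> s" unfolding s_def by (rule cInf_greatest[OF ne]) auto
  have before: "X' r = X r \<and> V' r = V r" if "0 \<le> r" "r < s" for r
    using that cInf_lower[OF _ bdd, of r] unfolding s_def by force
  have at_s: "X' s = X s \<and> V' s = V s"
  proof (cases "s = 0")
    case True
    then show ?thesis using solutionD[OF sol] solutionD[OF sol'] by simp
  next
    case False
    let ?f = "\<lambda>t. (X' t - X t, V' t - V t)"
    have "continuous_on {0..} X"
      by (rule continuous_on_has_vector_derivative, rule solutionD(4)[OF sol]) simp
    moreover have "continuous_on {0..} X'"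
      by (rule continuous_on_has_vector_derivative, rule solutionD(4)[OF sol']) simp
    ultimately have "continuous_on {0..} ?f"
      using solutionD(3)[OF sol] solutionD(3)[OF sol'] by (intro continuous_on_Pair continuous_on_diff)
    then have "closed {t \<in> {0..}. ?f t = 0}" by (rule continuous_closed_preimage_constant) auto
    moreover have "{0..<s} \<subseteq> {t \<in> {0..}. ?f t = 0}" using before by (auto simp: zero_prod_def)
    ultimately have "closure {0..<s} \<subseteq> {t \<in> {0..}. ?f t = 0}" by (simp add: closure_minimal)
    moreover have "closure {0..<s} = {0..s}" using False s by (simp add: closure_atLeastLessThan)
    moreover have "s \<in> {0..s}" using s by simp
    ultimately have "s \<in> {t \<in> {0..}. ?f t = 0}" by blast
    then show ?thesis by (simp add: zero_prod_def)
  qed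
  obtain e where e: "0 < e" "\<And>t. s \<le> t \<Longrightarrow> t \<le> s + e \<Longrightarrow> X' t = X t \<and> V' t = V t"
    by (rule local_uniqueness[OF sol sol' s conjunct1[OF at_s] conjunct2[OF at_s] tr[OF s]])
      (assumption | rule that)+
  have "s + e \<le> Inf ?D"
  proof (rule cInf_greatest[OF ne])
    fix r assume r: "r \<in> ?D"
    show "s + e \<le> r" 
    proof (rule ccontr)
      assume "\<not> s + e \<le> r"
      then have "X' r = X r \<and> V' r = V r"
        using r before[of r] e(2)[of r] by (cases "r < s") simp_all
      with r show False by simp
    qed
  qed
  with e(1) show False by (simp add: s_def)
qed

end

section \<open>Volume of nearly tangential states\<close>

text \<open>With n = floor(1/\<tau>) multiples in each direction, no translate moves by more than
  2\<kappa>, so n^2 disjoint copies fit into one ball. The factor 4 comes from 1/n <=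
  2\<tau>.\<close>

lemma emeasure_packing_ball_le:
  fixes A :: "'a::euclidean_space set" and \<alpha> \<beta> p :: "'a \<Rightarrow> real"
  assumes A: "open A" "A \<subseteq> ball 0 \<rho>" and \<tau>: "0 < \<tau>" "\<tau> \<le> 1"
    and u: "norm u \<le> \<kappa> * \<tau>" and w: "norm w \<le> \<kappa> * \<tau>"
    and bd: "\<And>z. z \<in> A \<Longrightarrow> 2 * s \<le> \<bar>p z\<bar> \<and> \<bar>\<alpha> z\<bar> < s \<and> \<bar>\<beta> z\<bar> < s"
    and p: "\<And>z k l. p (z + real k *\<^sub>R u + real l *\<^sub>R w) = p z"
    and \<alpha>: "\<And>z k l. \<alpha> (z + real k *\<^sub>R u + real l *\<^sub>R w) = \<alpha> z + real k * p z"
    and \<beta>: "\<And>z l. \<beta> (z + real l *\<^sub>R w) = \<beta> z + real l * p z"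
  shows "emeasure lborel A \<le> ennreal (4 * \<tau>\<^sup>2 * measure lborel (ball 0 (\<rho> + 2 * \<kappa>) :: 'a set))"
proof -
  let ?Q = "ball 0 (\<rho> + 2 * \<kappa>) :: 'a set"
  define n where "n = nat \<lfloor>1 / \<tau>\<rfloor>"
  have "1 \<le> 1 / \<tau>" using \<tau> by simp
  then have "1 \<le> \<lfloor>1 / \<tau>\<rfloor>" by (simp only: le_floor_iff of_int_1)
  then have "real n = of_int \<lfloor>1 / \<tau>\<rfloor>" unfolding n_def by (intro of_nat_nat) linarith
  with \<open>1 \<le> \<lfloor>1 / \<tau>\<rfloor>\<close> have n: "real n \<le> 1 / \<tau>" "1 / \<tau> \<le> 2 * real n" by linarith+
  have \<kappa>: "0 \<le> \<kappa>" using u \<tau>(1) norm_ge_zero[of u] by (meson order_trans zero_le_mult_iff not_le)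
  have small: "norm (real k *\<^sub>R y) \<le> \<kappa>" if "k < n" "norm y \<le> \<kappa> * \<tau>" for k and y :: 'a
  proof -
    have "real k \<le> 1 / \<tau>" using that(1) n(1) by linarith
    then have "real k * \<tau> \<le> 1" using \<tau>(1) by (simp add: pos_le_divide_eq)
    have "norm (real k *\<^sub>R y) \<le> real k * (\<kappa> * \<tau>)" using that(2) by (simp add: mult_left_mono)
    also have "\<dots> = \<kappa> * (real k * \<tau>)" by simp
    also have "\<dots> \<le> \<kappa> * 1" using \<open>real k * \<tau> \<le> 1\<close> \<kappa> by (rule mult_left_mono)
    finally show ?thesis by simp
  qed
  have "z + real k *\<^sub>R u + real l *\<^sub>R w \<in> ?Q" if "z \<in> A" "k < n" "l < n" for z k l
  proof -
    have "norm z < \<rho>" using that(1) A(2) by auto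
    moreover have "norm (z + real k *\<^sub>R u + real l *\<^sub>R w) \<le> norm z + norm (real k *\<^sub>R u) + norm (real l *\<^sub>R w)"
      by (meson norm_triangle_ineq norm_triangle_mono order_refl order_trans)
    ultimately have "norm (z + real k *\<^sub>R u + real l *\<^sub>R w) < \<rho> + 2 * \<kappa>"
      using small[OF that(2) u] small[OF that(3) w] by linarith
    then show ?thesis by simp
  qed
  then have "ennreal (real n ^ 2) * emeasure lborel A \<le> emeasure lborel ?Q"
    using A(1) by (intro emeasure_packing_le[OF _ _ bd p \<alpha> \<beta>]) auto
  also have "\<dots> = ennreal (measure lborel ?Q)"
    using emeasure_lborel_ball_finite[of "0 :: 'a" "\<rho> + 2 * \<kappa>"]
    by (intro emeasure_eq_ennreal_measure) (simp add: less_top)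
  finally have le: "ennreal (real n ^ 2) * emeasure lborel A \<le> ennreal (measure lborel ?Q)" .
  have "emeasure lborel A \<le> emeasure lborel (ball 0 \<rho> :: 'a set)"
    using A by (intro emeasure_mono) auto
  also have "\<dots> < top" using emeasure_lborel_ball_finite[of "0 :: 'a" \<rho>] by simp
  finally obtain m where m: "0 \<le> m" "emeasure lborel A = ennreal m"
    by (metis ennreal_cases less_irrefl)
  have "real n ^ 2 * m \<le> measure lborel ?Q"
    using le m by (simp add: ennreal_mult[symmetric])
  moreover have "1 \<le> 2 * real n * \<tau>" using n(2) \<tau>(1) by (simp add: pos_divide_le_eq)
  then have "1 \<le> (2 * real n * \<tau>)\<^sup>2" by (simp add: one_le_power)
  then have "m * 1 \<le> m * (2 * real n * \<tau>)\<^sup>2" using m(1) by (rule mult_left_mono)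
  then have "m \<le> 4 * \<tau>\<^sup>2 * (real n ^ 2 * m)" by (simp add: power_mult_distrib algebra_simps)
  ultimately have "m \<le> 4 * \<tau>\<^sup>2 * measure lborel ?Q"
    by (meson mult_left_mono order_trans zero_le_power2 mult_nonneg_nonneg zero_le_numeral)
  then show ?thesis using m(2) by (simp add: ennreal_leI)
qed

text \<open>For the tie factors a and b, vanishing of both means a triple collision. Restricting the
  single coordinate \<open>m\<close> of each gives two scalar conditions, which suffice in every
  dimension.\<close>

definition near_collision :: "real \<Rightarrow> real \<Rightarrow> 'd \<Rightarrow> (real ^ 'd ^ 'n \<Rightarrow> real ^ 'd) \<Rightarrow> (real ^ 'd ^ 'n \<Rightarrow> real ^ 'd) \<Rightarrow> ('d::finite, 'n::finite) phase set"
  where "near_collision \<rho> s m a b = {z. norm z < \<rho> \<and> \<bar>a (fst z) $ m\<bar> < s \<and> \<bar>b (fst z) $ m\<bar> < s}"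

text \<open>The lower bound on a coordinate of \<open>a\<close> makes the two small quantities vary
  independently when \<open>b\<close> is moved along that coordinate. \<open>a\<close> and
  \<open>b\<close> are parameters so that their roles can be exchanged.\<close>

definition near_tangency :: "real \<Rightarrow> real \<Rightarrow> real \<Rightarrow> 'd \<Rightarrow> (real ^ 'd ^ 'n \<Rightarrow> real ^ 'd) \<Rightarrow> (real ^ 'd ^ 'n \<Rightarrow> real ^ 'd) \<Rightarrow> ('d::finite, 'n::finite) phase set"
  where "near_tangency \<rho> s r m a b = {z. norm z < \<rho> \<and> \<bar>a (fst z) \<bullet> b (fst z)\<bar> < s
    \<and> \<bar>a (fst z) \<bullet> b (snd z) + a (snd z) \<bullet> b (fst z)\<bar> < s \<and> r < \<bar>a (fst z) $ m\<bar>}"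

lemma open_near_collision:
  assumes "linear a" "linear b"
  shows "open (near_collision \<rho> s m a b)"
proof -
  have [continuous_intros]: "continuous_on S (\<lambda>x. a (f x))" "continuous_on S (\<lambda>x. b (f x))" if "continuous_on S f" for S f
    using that assms by (auto intro: bounded_linear.continuous_on simp: linear_conv_bounded_linear)
  show ?thesis
    unfolding near_collision_def by (intro open_Collect_conj open_Collect_less continuous_intros)
qed

lemma open_near_tangency:
  assumes "linear a" "linear b"
  shows "open (near_tangency \<rho> s r m a b)"
proof -
  have [continuous_intros]: "continuous_on S (\<lambda>x. a (f x))" "continuous_on S (\<lambda>x. b (f x))" if "continuous_on S f" for S f
    using that assms by (auto intro: bounded_linear.continuous_on simp: linear_conv_bounded_linear)
  show ?thesis
    unfolding near_tangency_def by (intro open_Collect_conj open_Collect_less continuous_intros)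
qed

text \<open>\<open>u\<close> and \<open>w\<close> move the two restricted coordinates separately at
  unit speed, so multiples of 2s are far enough apart to separate the translates.\<close>

lemma emeasure_near_collision_le:
  assumes a: "linear a" and b: "linear b"
    and u: "a u = axis m 1" "b u = 0" "norm u \<le> \<kappa>" and w: "a w = 0" "b w = axis m 1" "norm w \<le> \<kappa>"
    and s: "0 < s" "2 * s \<le> 1"
  shows "emeasure lborel (near_collision \<rho> s m a b :: ('d::finite, 'n::finite) phase set)
    \<le> ennreal (16 * s\<^sup>2 * measure lborel (ball 0 (\<rho> + 2 * \<kappa>) :: ('d, 'n) phase set))"
proof -
  have "emeasure lborel (near_collision \<rho> s m a b)
      \<le> ennreal (4 * (2 * s)\<^sup>2 * measure lborel (ball 0 (\<rho> + 2 * \<kappa>) :: ('d, 'n) phase set))"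
  proof (rule emeasure_packing_ball_le[where s = s and p = "\<lambda>z. 2 * s" and u = "((2 * s) *\<^sub>R u, 0)"
        and w = "((2 * s) *\<^sub>R w, 0)" and \<alpha> = "\<lambda>z. a (fst z) $ m" and \<beta> = "\<lambda>z. b (fst z) $ m"])
    show "open (near_collision \<rho> s m a b)" by (rule open_near_collision[OF a b])
    show "near_collision \<rho> s m a b \<subseteq> ball 0 \<rho>" by (auto simp: near_collision_def)
    show "norm ((2 * s) *\<^sub>R u, 0) \<le> \<kappa> * (2 * s)" "norm ((2 * s) *\<^sub>R w, 0) \<le> \<kappa> * (2 * s)"
      using s(1) u(3) w(3) by (simp_all add: norm_Pair mult.commute)
  qed (use s in \<open>auto simp: near_collision_def linear_add[OF a] linear_scale[OF a] linear_add[OF b]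
      linear_scale[OF b] u w\<close>)
  then show ?thesis by (simp add: power_mult_distrib)
qed

text \<open>Shifting positions by \<open>\<tau> u\<close> changes the gap by \<tau> a_m, and
  shifting velocities by it changes the rate by the same amount without touching the gap. The choice
  \<tau> = 2s/r makes this amount at least 2s.\<close>

lemma emeasure_near_tangency_le:
  assumes a: "linear a" and b: "linear b"
    and u: "a u = 0" "b u = axis m 1" "norm u \<le> \<kappa>"
    and r: "0 < r" and s: "0 < s" "2 * s \<le> r"
  shows "emeasure lborel (near_tangency \<rho> s r m a b :: ('d::finite, 'n::finite) phase set)
    \<le> ennreal (16 * (s / r)\<^sup>2 * measure lborel (ball 0 (\<rho> + 2 * \<kappa>) :: ('d, 'n) phase set))"
proof -
  define \<tau> where "\<tau> = 2 * s / r"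
  have \<tau>: "0 < \<tau>" "\<tau> \<le> 1" using r s by (simp_all add: \<tau>_def)
  have "emeasure lborel (near_tangency \<rho> s r m a b)
      \<le> ennreal (4 * \<tau>\<^sup>2 * measure lborel (ball 0 (\<rho> + 2 * \<kappa>) :: ('d, 'n) phase set))"
  proof (rule emeasure_packing_ball_le[where s = s and p = "\<lambda>z. \<tau> * a (fst z) $ m" and u = "(\<tau> *\<^sub>R u, 0)"
        and w = "(0, \<tau> *\<^sub>R u)" and \<alpha> = "\<lambda>z. a (fst z) \<bullet> b (fst z)"
        and \<beta> = "\<lambda>z. a (fst z) \<bullet> b (snd z) + a (snd z) \<bullet> b (fst z)"])
    show "open (near_tangency \<rho> s r m a b)" by (rule open_near_tangency[OF a b])
    show "near_tangency \<rho> s r m a b \<subseteq> ball 0 \<rho>" by (auto simp: near_tangency_def)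
    show "norm (\<tau> *\<^sub>R u, 0) \<le> \<kappa> * \<tau>" "norm (0, \<tau> *\<^sub>R u) \<le> \<kappa> * \<tau>"
      using \<tau>(1) u(3) by (simp_all add: norm_Pair mult.commute)
    fix z :: "('d, 'n) phase" assume z: "z \<in> near_tangency \<rho> s r m a b"
    have "2 * s = \<tau> * r" using r by (simp add: \<tau>_def)
    also have "\<dots> \<le> \<tau> * \<bar>a (fst z) $ m\<bar>" using z \<tau>(1) by (simp add: near_tangency_def)
    finally show "2 * s \<le> \<bar>\<tau> * a (fst z) $ m\<bar> \<and> \<bar>a (fst z) \<bullet> b (fst z)\<bar> < s \<and>
        \<bar>a (fst z) \<bullet> b (snd z) + a (snd z) \<bullet> b (fst z)\<bar> < s"
      using z \<tau>(1) by (simp add: near_tangency_def abs_mult)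
  qed (use \<tau> in \<open>auto simp: linear_add[OF a] linear_scale[OF a] linear_add[OF b] linear_scale[OF b] u
      inner_add_right inner_axis algebra_simps\<close>)
  then show ?thesis by (simp add: \<tau>_def power_mult_distrib power_divide)
qed

section \<open>A finite family of open sets catching tangential trajectories\<close>

lemma abs_inner_diff_le:
  assumes "norm a \<le> A" "norm b' \<le> B" "norm (a - a') \<le> A' * d" "norm (b - b') \<le> B' * d"
  shows "\<bar>a \<bullet> b - a' \<bullet> b'\<bar> \<le> (A * B' + A' * B) * d"
proof -
  have A: "0 \<le> A" "0 \<le> B" "0 \<le> A' * d" using assms norm_ge_zero order_trans by blast+
  have "a \<bullet> b - a' \<bullet> b' = a \<bullet> (b - b') + (a - a') \<bullet> b'" by (simp add: algebra_simps)
  also have "\<bar>\<dots>\<bar> \<le> norm a * norm (b - b') + norm (a - a') * norm b'"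
    by (intro order_trans[OF abs_triangle_ineq] add_mono Cauchy_Schwarz_ineq2)
  also have "\<dots> \<le> A * (B' * d) + (A' * d) * B"
    using assms A by (intro add_mono mult_mono) auto
  finally show ?thesis by (simp add: algebra_simps)
qed

lemma sum_Un_le_ennreal:
  fixes f :: "'a \<Rightarrow> ennreal"
  assumes "finite A" "finite B"
  shows "sum f (A \<union> B) \<le> sum f A + sum f B"
proof -
  have "sum f (A \<union> B) \<le> sum f (A \<union> B) + sum f (A \<inter> B)" by simp
  also have "\<dots> = sum f A + sum f B" by (rule sum.union_inter[OF assms])
  finally show ?thesis .
qed

lemma sum_image_le_card:
  fixes f :: "'b \<Rightarrow> ennreal"
  assumes I: "finite I" and C: "0 \<le> C" and f: "\<And>i. i \<in> I \<Longrightarrow> f (g i) \<le> ennreal C"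
  shows "sum f (g ` I) \<le> ennreal (real (card I) * C)"
proof -
  have "sum f (g ` I) \<le> sum (f \<circ> g) I" by (rule sum_image_le) (use I in auto)
  also have "\<dots> \<le> of_nat (card I) * ennreal C" by (rule sum_bounded_above) (use f in auto)
  also have "\<dots> = ennreal (real (card I) * C)" using C by (simp add: ennreal_mult ennreal_of_nat_eq_real_of_nat)
  finally show ?thesis .
qed

lemma floor_grid:
  fixes \<delta> s T :: real
  assumes \<delta>: "0 < \<delta>" and s: "0 \<le> s" "s \<le> T"
  obtains p where "p \<le> nat \<lfloor>T / \<delta>\<rfloor>" "real p * \<delta> \<le> s" "s - real p * \<delta> \<le> \<delta>"
proof
  have le: "0 \<le> s / \<delta>" "s / \<delta> \<le> T / \<delta>" using assms by (simp_all add: divide_right_mono)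
  then show "nat \<lfloor>s / \<delta>\<rfloor> \<le> nat \<lfloor>T / \<delta>\<rfloor>" by (intro nat_mono floor_mono)
  have "real (nat \<lfloor>s / \<delta>\<rfloor>) \<le> s / \<delta>" "s / \<delta> \<le> real (nat \<lfloor>s / \<delta>\<rfloor>) + 1" using le(1) by linarith+
  then have 1: "real (nat \<lfloor>s / \<delta>\<rfloor>) * \<delta> \<le> s" and 2: "s \<le> (real (nat \<lfloor>s / \<delta>\<rfloor>) + 1) * \<delta>"
    using \<delta> by (simp_all only: pos_le_divide_eq pos_divide_le_eq)
  show "real (nat \<lfloor>s / \<delta>\<rfloor>) * \<delta> \<le> s" by (rule 1)
  show "s - real (nat \<lfloor>s / \<delta>\<rfloor>) * \<delta> \<le> \<delta>" using 2 by (simp add: algebra_simps)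
qed

text \<open>The product rule with |a| <= 2M and |b| <= 4M on positions and velocities: the rate has
  two products of Lipschitz constant 8(ML + MM) each, and 4M serves the coordinates. The final 1
  keeps \<open>\<Lambda>\<close> positive, as it is a divisor later.\<close>

lemma tie_rate_lipschitz:
  fixes X V :: "real \<Rightarrow> real ^ 'd ^ 'n"
  assumes M: "0 \<le> M" and L: "0 \<le> L" and ts: "t \<le> s"
    and X: "\<And>i. norm (X t $ i) \<le> M" "\<And>i. norm (X s $ i) \<le> M"
    and V: "\<And>i. norm (V t $ i) \<le> M" "\<And>i. norm (V s $ i) \<le> M"
    and dX: "\<And>i. norm (X s $ i - X t $ i) \<le> M * (s - t)"
    and dV: "\<And>i. norm (V s $ i - V t $ i) \<le> L * (s - t)"
  defines "\<Lambda> \<equiv> 16 * (M * L + M * M) + 4 * M + 1"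
  shows "\<bar>(X s $ i - X s $ j) $ m - (X t $ i - X t $ j) $ m\<bar> \<le> \<Lambda> * (s - t)"
    and "\<bar>(X s $ i + X s $ j - 2 *\<^sub>R X s $ c) $ m - (X t $ i + X t $ j - 2 *\<^sub>R X t $ c) $ m\<bar> \<le> \<Lambda> * (s - t)"
    and "\<bar>tie_gap (X s) c i j - tie_gap (X t) c i j\<bar> \<le> \<Lambda> * (s - t)"
    and "\<bar>tie_rate (X s) (V s) c i j - tie_rate (X t) (V t) c i j\<bar> \<le> \<Lambda> * (s - t)"
proof -
  let ?a = "\<lambda>x :: real ^ 'd ^ 'n. x $ i - x $ j" and ?b = "\<lambda>x :: real ^ 'd ^ 'n. x $ i + x $ j - 2 *\<^sub>R x $ c"
  have na: "norm (?a x) \<le> 2 * R" and nb: "norm (?b x) \<le> 4 * R" if "\<And>k. norm (x $ k) \<le> R" for x R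
  proof -
    show "norm (?a x) \<le> 2 * R"
      using norm_triangle_ineq4[of "x $ i" "x $ j"] that[of i] that[of j] by linarith
    have "norm (?b x) \<le> norm (x $ i) + norm (x $ j) + norm (2 *\<^sub>R x $ c)"
      using norm_triangle_ineq4[of "x $ i + x $ j" "2 *\<^sub>R x $ c"] norm_triangle_ineq[of "x $ i" "x $ j"] by linarith
    then show "norm (?b x) \<le> 4 * R" using that[of i] that[of j] that[of c] by simp
  qed
  have da: "norm (?a (X s) - ?a (X t)) \<le> (2 * M) * (s - t)" "norm (?a (V s) - ?a (V t)) \<le> (2 * L) * (s - t)"
    using na[of "X s - X t" "M * (s - t)"] na[of "V s - V t" "L * (s - t)"] dX dV by (simp_all add: algebra_simps)
  have db: "norm (?b (X s) - ?b (X t)) \<le> (4 * M) * (s - t)" "norm (?b (V s) - ?b (V t)) \<le> (4 * L) * (s - t)"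
    using nb[of "X s - X t" "M * (s - t)"] nb[of "V s - V t" "L * (s - t)"] dX dV by (simp_all add: algebra_simps)
  have pos: "0 \<le> M * L" "0 \<le> M * M" using M L by simp_all
  have \<Lambda>: "2 * M \<le> \<Lambda>" "4 * M \<le> \<Lambda>" "16 * (M * M) \<le> \<Lambda>" "16 * (M * L + M * M) \<le> \<Lambda>"
    using M pos unfolding \<Lambda>_def by simp_all
  note up = order_trans[OF _ mult_right_mono]
  have st: "0 \<le> s - t" using ts by simp
  have "\<bar>?a (X s) $ m - ?a (X t) $ m\<bar> \<le> 2 * M * (s - t)"
    using order_trans[OF component_le_norm_cart da(1), of m] by (simp add: vector_minus_component)
  then show "\<bar>?a (X s) $ m - ?a (X t) $ m\<bar> \<le> \<Lambda> * (s - t)" by (rule up[OF _ \<Lambda>(1) st])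
  have "\<bar>?b (X s) $ m - ?b (X t) $ m\<bar> \<le> 4 * M * (s - t)"
    using order_trans[OF component_le_norm_cart db(1), of m] by (simp add: vector_minus_component)
  then show "\<bar>?b (X s) $ m - ?b (X t) $ m\<bar> \<le> \<Lambda> * (s - t)" by (rule up[OF _ \<Lambda>(2) st])
  have "\<bar>?a (X s) \<bullet> ?b (X s) - ?a (X t) \<bullet> ?b (X t)\<bar> \<le> (2 * M * (4 * M) + 2 * M * (4 * M)) * (s - t)"
    by (intro abs_inner_diff_le na nb X da db)
  then show "\<bar>tie_gap (X s) c i j - tie_gap (X t) c i j\<bar> \<le> \<Lambda> * (s - t)"
    unfolding tie_gap_def by (rule up[OF _ _ st]) (use \<Lambda>(3) in simp)
  have 1: "\<bar>?a (X s) \<bullet> ?b (V s) - ?a (X t) \<bullet> ?b (V t)\<bar> \<le> (2 * M * (4 * L) + 2 * M * (4 * M)) * (s - t)"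
    by (intro abs_inner_diff_le na nb X V da db)
  have 2: "\<bar>?a (V s) \<bullet> ?b (X s) - ?a (V t) \<bullet> ?b (X t)\<bar> \<le> (2 * M * (4 * M) + 2 * L * (4 * M)) * (s - t)"
    by (intro abs_inner_diff_le na nb X V da db)
  have "\<bar>tie_rate (X s) (V s) c i j - tie_rate (X t) (V t) c i j\<bar> \<le> (16 * (M * L + M * M)) * (s - t)"
    using 1 2 unfolding tie_rate_def by (simp add: algebra_simps)
  then show "\<bar>tie_rate (X s) (V s) c i j - tie_rate (X t) (V t) c i j\<bar> \<le> \<Lambda> * (s - t)"
    by (rule up[OF _ \<Lambda>(4) st])
qed

text \<open>Quantifies over all curves with the given bounds instead of solutions, so that the
  family is fixed before the datum and the limit trajectory are.\<close>

definition catches ::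
    "real \<Rightarrow> real \<Rightarrow> real \<Rightarrow> (real \<times> ('d::finite, 'n::finite) phase set) set \<Rightarrow> bool" where
  "catches M L T Q \<longleftrightarrow> (\<forall>X V s. 0 \<le> s \<longrightarrow> s \<le> T \<longrightarrow>
      (\<forall>t i. 0 \<le> t \<longrightarrow> t \<le> T \<longrightarrow> norm (X t $ i) \<le> M) \<longrightarrow>
      (\<forall>t i. 0 \<le> t \<longrightarrow> t \<le> T \<longrightarrow> norm (V t $ i) \<le> M) \<longrightarrow>
      (\<forall>r t i. 0 \<le> r \<longrightarrow> r \<le> t \<longrightarrow> t \<le> T \<longrightarrow> norm (X t $ i - X r $ i) \<le> M * (t - r)) \<longrightarrow>
      (\<forall>r t i. 0 \<le> r \<longrightarrow> r \<le> t \<longrightarrow> t \<le> T \<longrightarrow> norm (V t $ i - V r $ i) \<le> L * (t - r)) \<longrightarrow>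
      \<not> transversal (X s) (V s) \<longrightarrow> (\<exists>(t, A)\<in>Q. (X t, V t) \<in> A))"

text \<open>
  Two scales are needed: near collisions (\<open>|a|, |b| = O(\<epsilon>)\<close> in one coordinate, volume \<open>O(\<epsilon>\<^sup>2)\<close>) are looked
  for on a time grid of size \<open>O(\<epsilon>)\<close>, near tangencies (volume \<open>O((\<epsilon>\<^sup>3 / \<epsilon>)\<^sup>2)\<close>) on a grid of size
  \<open>O(\<epsilon>\<^sup>3)\<close>. In both cases the total is \<open>O(\<epsilon>)\<close>.
\<close>

lemma finite_catching_family:
  fixes M L T \<eta> :: real
  assumes M: "0 \<le> M" and L: "0 \<le> L" and T: "0 \<le> T" and \<eta>: "0 < \<eta>"
  obtains Q :: "(real \<times> ('d::finite, 'n::finite) phase set) set"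
  where "finite Q" "\<And>t A. (t, A) \<in> Q \<Longrightarrow> 0 \<le> t \<and> t \<le> T \<and> open A"
    "(\<Sum>(t, A)\<in>Q. emeasure lborel A) \<le> ennreal \<eta>"
    "catches M L T Q"
proof -
  fix m :: 'd
  define a where "a i j x = x $ i - x $ j" for i j and x :: "real ^ 'd ^ 'n"
  define b where "b c i j x = x $ i + x $ j - 2 *\<^sub>R x $ c" for c i j and x :: "real ^ 'd ^ 'n"
  have lin: "linear (a i j)" "linear (b c i j)" for c i j
    by (rule linearI; simp add: a_def b_def algebra_simps)+
  define e :: "real ^ 'd" where "e = axis m 1"
  have ne: "norm e = 1" by (simp add: e_def norm_axis_1)
  \<comment> \<open>Moving agents i and j by opposite halves of \<open>e\<close> changes their
    difference by \<open>e\<close> and keeps their sum; moving agent c by minus half of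
    \<open>e\<close> changes only b, by \<open>e\<close>.\<close>
  define ua :: "'n \<Rightarrow> 'n \<Rightarrow> real ^ 'd ^ 'n"
    where "ua i j = (\<chi> k. if k = i then (1/2) *\<^sub>R e else if k = j then - (1/2) *\<^sub>R e else 0)" for i j
  define ub :: "'n \<Rightarrow> real ^ 'd ^ 'n" where "ub c = (\<chi> k. if k = c then - (1/2) *\<^sub>R e else 0)" for c
  define \<kappa> where "\<kappa> = real CARD('n)"
  have nu: "norm (ua i j) \<le> \<kappa>" "norm (ub c) \<le> \<kappa>" for i j c
    using norm_le_card_mult[of "ua i j" 1] norm_le_card_mult[of "ub c" 1] ne by (auto simp: ua_def ub_def \<kappa>_def)
  have shift: "a i j (ua i j) = axis m 1" "b c i j (ua i j) = 0" "a i j (ub c) = 0" "b c i j (ub c) = axis m 1"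
    if "distinct [c, i, j]" for c i j
    using that by (auto simp: a_def b_def ua_def ub_def e_def[symmetric] scaleR_left_distrib[symmetric])
  define \<Lambda> where "\<Lambda> = 16 * (M * L + M * M) + 4 * M + 1"
  have \<Lambda>: "0 < \<Lambda>" unfolding \<Lambda>_def using M L by (intro add_nonneg_pos add_nonneg_nonneg mult_nonneg_nonneg) auto
  define \<rho> where "\<rho> = 2 * \<kappa> * M + 1"
  define vol where "vol = measure lborel (ball 0 (\<rho> + 2 * \<kappa>) :: ('d, 'n) phase set)"
  have vol: "0 \<le> vol" by (simp add: vol_def)
  define D where "D = {(c :: 'n, i :: 'n, j :: 'n). distinct [c, i, j]}"
  \<comment> \<open>256 is 16 * 4^2 for near collisions of width 4\<epsilon>, and 32 is twice 16 for
    the two families of near tangencies. The brackets bound the numbers of grid times multiplied by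
    \<epsilon> and \<epsilon>^3.\<close>
  define C where "C = real (card D) * vol * (256 * (T * \<Lambda> + 1) + 32 * (2 * T * \<Lambda> + 1))"
  have C: "0 \<le> C" unfolding C_def using vol T \<Lambda> by (intro mult_nonneg_nonneg add_nonneg_nonneg) auto
  \<comment> \<open>The cap 1/8 ensures 2 * 4\<epsilon> <= 1, as the near-collision estimate
    requires.\<close>
  define \<epsilon> where "\<epsilon> = min (1/8) (\<eta> / (C + 1))"
  have \<epsilon>: "0 < \<epsilon>" "\<epsilon> \<le> 1/8" "C * \<epsilon> \<le> \<eta>"
  proof -
    show "0 < \<epsilon>" using \<eta> C by (simp add: \<epsilon>_def)
    show "\<epsilon> \<le> 1/8" unfolding \<epsilon>_def by (rule min.cobounded1)
    have "C * \<epsilon> \<le> C * (\<eta> / (C + 1))" using C unfolding \<epsilon>_def by (intro mult_left_mono min.cobounded2)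
    also have "\<dots> \<le> \<eta>" using C \<eta> by (simp add: field_simps)
    finally show "C * \<epsilon> \<le> \<eta>" .
  qed
  have cube: "\<epsilon> ^ 3 \<le> \<epsilon> / 2"
  proof -
    have "\<epsilon> * \<epsilon> \<le> 1 / 2 * 1" using \<epsilon> by (intro mult_mono) auto
    then have "\<epsilon> * (\<epsilon> * \<epsilon>) \<le> \<epsilon> * (1 / 2)" using \<epsilon>(1) by (intro mult_left_mono) auto
    then show ?thesis by (simp add: power3_eq_cube mult.assoc)
  qed
  \<comment> \<open>Within one coarse cell coordinates change by at most \<epsilon>; within one fine
    cell gap and rate change by at most \<epsilon>^3 / 2, which leaves room for strict
    inequalities.\<close>
  define \<delta>1 where "\<delta>1 = \<epsilon> / \<Lambda>"
  define \<delta>2 where "\<delta>2 = \<epsilon> ^ 3 / (2 * \<Lambda>)"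
  have \<delta>: "0 < \<delta>1" "0 < \<delta>2" using \<epsilon> \<Lambda> by (simp_all add: \<delta>1_def \<delta>2_def)
  define I1 where "I1 = {..nat \<lfloor>T / \<delta>1\<rfloor>} \<times> D"
  define I2 where "I2 = {..nat \<lfloor>T / \<delta>2\<rfloor>} \<times> D"
  define g1 where "g1 = (\<lambda>(p, c, i, j). (real p * \<delta>1, near_collision \<rho> (4 * \<epsilon>) m (a i j) (b c i j)))"
  define g2 where "g2 = (\<lambda>(p, c, i, j). (real p * \<delta>2, near_tangency \<rho> (\<epsilon> ^ 3) \<epsilon> m (a i j) (b c i j)))"
  define g3 where "g3 = (\<lambda>(p, c, i, j). (real p * \<delta>2, near_tangency \<rho> (\<epsilon> ^ 3) \<epsilon> m (b c i j) (a i j)))"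
  have "finite D" by (rule finite_subset[OF subset_UNIV]) simp
  then have fin: "finite I1" "finite I2" by (simp_all add: I1_def I2_def)
  define Q where "Q = g1 ` I1 \<union> (g2 ` I2 \<union> g3 ` I2)"
  have grid: "real p * \<delta> \<le> T" if "p \<le> nat \<lfloor>T / \<delta>\<rfloor>" "0 < \<delta>" for p \<delta>
  proof -
    have "0 \<le> T / \<delta>" using T that(2) by simp
    with that(1) have "real p \<le> T / \<delta>" by linarith
    with that(2) show ?thesis by (simp add: pos_le_divide_eq)
  qed
  have m1: "emeasure lborel (snd (g1 q)) \<le> ennreal (256 * \<epsilon>\<^sup>2 * vol)" if "q \<in> I1" for q
  proof -
    obtain p c i j where q: "q = (p, c, i, j)" by (metis surj_pair)
    with that have "distinct [c, i, j]" by (simp add: I1_def D_def)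
    note sh = shift[OF this]
    have "emeasure lborel (near_collision \<rho> (4 * \<epsilon>) m (a i j) (b c i j)) \<le> ennreal (16 * (4 * \<epsilon>)\<^sup>2 * vol)"
      unfolding vol_def by (rule emeasure_near_collision_le[OF lin sh(1,2) nu(1) sh(3,4) nu(2)]) (use \<epsilon> in auto)
    then show ?thesis by (simp add: q g1_def power_mult_distrib)
  qed
  have q4: "(\<epsilon> ^ 3 / \<epsilon>)\<^sup>2 = \<epsilon> ^ 4" using \<epsilon>(1) by (simp add: power_divide eval_nat_numeral)
  have m2: "emeasure lborel (snd (g2 q)) \<le> ennreal (16 * \<epsilon> ^ 4 * vol)"
    and m3: "emeasure lborel (snd (g3 q)) \<le> ennreal (16 * \<epsilon> ^ 4 * vol)" if "q \<in> I2" for q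
  proof -
    obtain p c i j where q: "q = (p, c, i, j)" by (metis surj_pair)
    with that have "distinct [c, i, j]" by (simp add: I2_def D_def)
    note sh = shift[OF this]
    have "emeasure lborel (near_tangency \<rho> (\<epsilon> ^ 3) \<epsilon> m (a i j) (b c i j)) \<le> ennreal (16 * (\<epsilon> ^ 3 / \<epsilon>)\<^sup>2 * vol)"
      unfolding vol_def by (rule emeasure_near_tangency_le[OF lin sh(3,4) nu(2)]) (use \<epsilon> cube in auto)
    then show "emeasure lborel (snd (g2 q)) \<le> ennreal (16 * \<epsilon> ^ 4 * vol)" by (simp add: q g2_def q4)
    have "emeasure lborel (near_tangency \<rho> (\<epsilon> ^ 3) \<epsilon> m (b c i j) (a i j)) \<le> ennreal (16 * (\<epsilon> ^ 3 / \<epsilon>)\<^sup>2 * vol)"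
      unfolding vol_def by (rule emeasure_near_tangency_le[OF lin(2,1) sh(2,1) nu(1)]) (use \<epsilon> cube in auto)
    then show "emeasure lborel (snd (g3 q)) \<le> ennreal (16 * \<epsilon> ^ 4 * vol)" by (simp add: q g3_def q4)
  qed
  have card1: "real (card I1) * (256 * \<epsilon>\<^sup>2 * vol) \<le> real (card D) * vol * (256 * (T * \<Lambda> + 1)) * \<epsilon>"
  proof -
    have "real (nat \<lfloor>T / \<delta>1\<rfloor>) \<le> T * \<Lambda> / \<epsilon>"
      using T \<Lambda> \<epsilon>(1) by (simp add: \<delta>1_def)
    then have "(real (nat \<lfloor>T / \<delta>1\<rfloor>) + 1) * \<epsilon> \<le> (T * \<Lambda> / \<epsilon> + 1) * \<epsilon>" using \<epsilon>(1) by (intro mult_right_mono) auto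
    also have "\<dots> \<le> T * \<Lambda> + 1" using \<epsilon> by (simp add: field_simps)
    finally have "(real (nat \<lfloor>T / \<delta>1\<rfloor>) + 1) * \<epsilon> * (256 * real (card D) * vol * \<epsilon>)
        \<le> (T * \<Lambda> + 1) * (256 * real (card D) * vol * \<epsilon>)" using vol \<epsilon>(1) by (intro mult_right_mono) auto
    then show ?thesis by (simp add: I1_def card_cartesian_product power2_eq_square algebra_simps)
  qed
  have card2: "real (card I2) * (16 * \<epsilon> ^ 4 * vol) \<le> real (card D) * vol * (16 * (2 * T * \<Lambda> + 1)) * \<epsilon>"
  proof -
    have "real (nat \<lfloor>T / \<delta>2\<rfloor>) \<le> 2 * T * \<Lambda> / \<epsilon> ^ 3"
      using T \<Lambda> \<epsilon>(1) by (simp add: \<delta>2_def mult.commute mult.left_commute)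
    then have "(real (nat \<lfloor>T / \<delta>2\<rfloor>) + 1) * \<epsilon> ^ 3 \<le> (2 * T * \<Lambda> / \<epsilon> ^ 3 + 1) * \<epsilon> ^ 3" using \<epsilon>(1) by (intro mult_right_mono) auto
    also have "\<dots> = 2 * T * \<Lambda> + \<epsilon> ^ 3" using \<epsilon> by (simp add: distrib_right)
    also have "\<dots> \<le> 2 * T * \<Lambda> + 1" using cube \<epsilon> by simp
    finally have "(real (nat \<lfloor>T / \<delta>2\<rfloor>) + 1) * \<epsilon> ^ 3 * (16 * real (card D) * vol * \<epsilon>)
        \<le> (2 * T * \<Lambda> + 1) * (16 * real (card D) * vol * \<epsilon>)" using vol \<epsilon>(1) by (intro mult_right_mono) auto
    moreover have "\<epsilon> ^ 4 = \<epsilon> ^ 3 * \<epsilon>" by (simp add: eval_nat_numeral)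
    ultimately show ?thesis by (simp add: I2_def card_cartesian_product algebra_simps)
  qed
  have "(\<Sum>q\<in>Q. emeasure lborel (snd q)) \<le> (\<Sum>q\<in>g1 ` I1. emeasure lborel (snd q)) +
      ((\<Sum>q\<in>g2 ` I2. emeasure lborel (snd q)) + (\<Sum>q\<in>g3 ` I2. emeasure lborel (snd q)))"
    unfolding Q_def using fin by (intro order_trans[OF sum_Un_le_ennreal] add_left_mono sum_Un_le_ennreal) auto
  also have "\<dots> \<le> ennreal (real (card I1) * (256 * \<epsilon>\<^sup>2 * vol)) +
      (ennreal (real (card I2) * (16 * \<epsilon> ^ 4 * vol)) + ennreal (real (card I2) * (16 * \<epsilon> ^ 4 * vol)))"
    by (intro add_mono sum_image_le_card fin m1 m2 m3) (use vol \<epsilon> in auto)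
  also have "\<dots> = ennreal (real (card I1) * (256 * \<epsilon>\<^sup>2 * vol) +
      (real (card I2) * (16 * \<epsilon> ^ 4 * vol) + real (card I2) * (16 * \<epsilon> ^ 4 * vol)))"
    using vol \<epsilon>(1) by (simp only: ennreal_plus mult_nonneg_nonneg add_nonneg_nonneg of_nat_0_le_iff
      zero_le_power less_imp_le zero_le_numeral zero_le_power2)
  also have "\<dots> \<le> ennreal (C * \<epsilon>)"
    by (rule ennreal_leI) (use card1 card2 in \<open>simp add: C_def algebra_simps\<close>)
  also have "\<dots> \<le> ennreal \<eta>" by (rule ennreal_leI[OF \<epsilon>(3)])
  finally have sum: "(\<Sum>(t, A)\<in>Q. emeasure lborel A) \<le> ennreal \<eta>" by (simp add: case_prod_unfold)
  show thesis
  proof (rule that[of Q])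
    show "finite Q" using fin by (simp add: Q_def)
    show "(\<Sum>(t, A)\<in>Q. emeasure lborel A) \<le> ennreal \<eta>" by (rule sum)
    fix t A assume "(t, A) \<in> Q"
    then show "0 \<le> t \<and> t \<le> T \<and> open A"
      using \<delta> grid by (auto simp: Q_def g1_def g2_def g3_def I1_def I2_def
          intro!: open_near_collision open_near_tangency lin)
  next
    show "catches M L T Q"
      unfolding catches_def
    proof (intro allI impI)
      fix X V :: "real \<Rightarrow> real ^ 'd ^ 'n" and s :: real
      assume s: "0 \<le> s" "s \<le> T"
        and X': "\<forall>t i. 0 \<le> t \<longrightarrow> t \<le> T \<longrightarrow> norm (X t $ i) \<le> M"
        and V': "\<forall>t i. 0 \<le> t \<longrightarrow> t \<le> T \<longrightarrow> norm (V t $ i) \<le> M"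
        and dX': "\<forall>r t i. 0 \<le> r \<longrightarrow> r \<le> t \<longrightarrow> t \<le> T \<longrightarrow> norm (X t $ i - X r $ i) \<le> M * (t - r)"
        and dV': "\<forall>r t i. 0 \<le> r \<longrightarrow> r \<le> t \<longrightarrow> t \<le> T \<longrightarrow> norm (V t $ i - V r $ i) \<le> L * (t - r)"
      note X = X'[rule_format] and V = V'[rule_format] and dX = dX'[rule_format] and dV = dV'[rule_format]
      assume "\<not> transversal (X s) (V s)"
      then obtain c i j where d: "distinct [c, i, j]"
        and tie: "tie_gap (X s) c i j = 0" "tie_rate (X s) (V s) c i j = 0"
        unfolding transversal_def by blast
      have gap: "tie_gap x c i j = a i j x \<bullet> b c i j x"
        and rate: "tie_rate x v c i j = a i j x \<bullet> b c i j v + a i j v \<bullet> b c i j x" for x v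
        by (simp_all add: tie_gap_def tie_rate_def a_def b_def)
      have near: "\<bar>a i j (X s) $ m - a i j (X t) $ m\<bar> \<le> \<Lambda> * (s - t)"
        "\<bar>b c i j (X s) $ m - b c i j (X t) $ m\<bar> \<le> \<Lambda> * (s - t)"
        "\<bar>tie_gap (X t) c i j\<bar> \<le> \<Lambda> * (s - t)" "\<bar>tie_rate (X t) (V t) c i j\<bar> \<le> \<Lambda> * (s - t)"
        "norm (X t, V t) < \<rho>" if t: "0 \<le> t" "t \<le> s" for t
      proof -
        have t': "t \<le> T" using t s by simp
        note lip = tie_rate_lipschitz[OF M L t(2) X[OF t(1) t'] X[OF s] V[OF t(1) t'] V[OF s] dX[OF t s(2)] dV[OF t s(2)]]
        show "\<bar>a i j (X s) $ m - a i j (X t) $ m\<bar> \<le> \<Lambda> * (s - t)"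
          using lip(1)[of i j m] by (simp only: a_def \<Lambda>_def)
        show "\<bar>b c i j (X s) $ m - b c i j (X t) $ m\<bar> \<le> \<Lambda> * (s - t)"
          using lip(2)[of i j c m] by (simp only: b_def \<Lambda>_def)
        show "\<bar>tie_gap (X t) c i j\<bar> \<le> \<Lambda> * (s - t)"
          using lip(3)[of c i j] by (simp add: tie \<Lambda>_def)
        show "\<bar>tie_rate (X t) (V t) c i j\<bar> \<le> \<Lambda> * (s - t)"
          using lip(4)[of c i j] by (simp add: tie \<Lambda>_def)
        have "norm (X t, V t) \<le> norm (X t) + norm (V t)"
          by (simp add: norm_Pair sqrt_sum_squares_le_sum)
        also have "\<dots> \<le> \<kappa> * M + \<kappa> * M"
          unfolding \<kappa>_def by (intro add_mono norm_le_card_mult X V t(1) t')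
        finally show "norm (X t, V t) < \<rho>" by (simp add: \<rho>_def mult.commute)
      qed
      show "\<exists>(t, A)\<in>Q. (X t, V t) \<in> A"
      \<comment> \<open>The threshold 2\<epsilon> survives the move back to a grid time in both
        directions: small coordinates stay below 4\<epsilon> on the coarse grid, and a large one
        stays above \<epsilon> on the fine grid.\<close>
      proof (cases "\<bar>a i j (X s) $ m\<bar> \<le> 2 * \<epsilon> \<and> \<bar>b c i j (X s) $ m\<bar> \<le> 2 * \<epsilon>")
        case True
        obtain p where p: "p \<le> nat \<lfloor>T / \<delta>1\<rfloor>" "real p * \<delta>1 \<le> s" "s - real p * \<delta>1 \<le> \<delta>1"
          by (rule floor_grid[OF \<delta>(1) s])
        let ?t = "real p * \<delta>1"
        have t: "0 \<le> ?t" using \<delta>(1) by simp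
        have "\<Lambda> * (s - ?t) \<le> \<Lambda> * \<delta>1" using p(3) \<Lambda> by (intro mult_left_mono) auto
        also have "\<dots> = \<epsilon>" using \<Lambda> by (simp add: \<delta>1_def)
        finally have "\<bar>a i j (X ?t) $ m\<bar> < 4 * \<epsilon>" "\<bar>b c i j (X ?t) $ m\<bar> < 4 * \<epsilon>"
          using near(1,2)[OF t p(2)] True \<epsilon>(1) by linarith+
        then have "(X ?t, V ?t) \<in> near_collision \<rho> (4 * \<epsilon>) m (a i j) (b c i j)"
          using near(5)[OF t p(2)] by (simp add: near_collision_def)
        moreover have "g1 (p, c, i, j) \<in> Q"
          unfolding Q_def using p(1) d by (intro UnI1 imageI) (simp add: I1_def D_def)
        ultimately show ?thesis by (auto simp: g1_def)
      next
        case False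
        obtain p where p: "p \<le> nat \<lfloor>T / \<delta>2\<rfloor>" "real p * \<delta>2 \<le> s" "s - real p * \<delta>2 \<le> \<delta>2"
          by (rule floor_grid[OF \<delta>(2) s])
        let ?t = "real p * \<delta>2"
        have t: "0 \<le> ?t" using \<delta>(2) by simp
        have "\<Lambda> * (s - ?t) \<le> \<Lambda> * \<delta>2" using p(3) \<Lambda> by (intro mult_left_mono) auto
        also have "\<dots> = \<epsilon> ^ 3 / 2" using \<Lambda> by (simp add: \<delta>2_def)
        finally have le: "\<Lambda> * (s - ?t) \<le> \<epsilon> ^ 3 / 2" .
        have pos: "0 < \<epsilon> ^ 3" using \<epsilon>(1) by simp
        have g: "\<bar>tie_gap (X ?t) c i j\<bar> < \<epsilon> ^ 3" "\<bar>tie_rate (X ?t) (V ?t) c i j\<bar> < \<epsilon> ^ 3"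
          using near(3,4)[OF t p(2)] le pos by linarith+
        from False consider "2 * \<epsilon> < \<bar>a i j (X s) $ m\<bar>" | "2 * \<epsilon> < \<bar>b c i j (X s) $ m\<bar>" by linarith
        then show ?thesis
        proof cases
          case 1
          then have "\<epsilon> < \<bar>a i j (X ?t) $ m\<bar>" using near(1)[OF t p(2)] le cube \<epsilon>(1) by linarith
          then have "(X ?t, V ?t) \<in> near_tangency \<rho> (\<epsilon> ^ 3) \<epsilon> m (a i j) (b c i j)"
            using near(5)[OF t p(2)] g by (simp add: near_tangency_def gap rate)
          moreover have "g2 (p, c, i, j) \<in> Q"
            unfolding Q_def using p(1) d by (intro UnI2 UnI1 imageI) (simp add: I2_def D_def)
          ultimately show ?thesis by (auto simp: g2_def)
        next
          case 2
          then have "\<epsilon> < \<bar>b c i j (X ?t) $ m\<bar>" using near(2)[OF t p(2)] le cube \<epsilon>(1) by linarith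
          then have "(X ?t, V ?t) \<in> near_tangency \<rho> (\<epsilon> ^ 3) \<epsilon> m (b c i j) (a i j)"
            using near(5)[OF t p(2)] g
            by (simp add: near_tangency_def gap rate inner_commute add.commute)
          moreover have "g3 (p, c, i, j) \<in> Q"
            unfolding Q_def using p(1) d by (intro UnI2 imageI) (simp add: I2_def D_def)
          ultimately show ?thesis by (auto simp: g3_def)
        qed
      qed
    qed
  qed
qed

section \<open>The exceptional null set\<close>

text \<open>Step functions are equicontinuous only up to \<open>h n\<close>; as this error vanishes,
  the usual three-term Cauchy estimate still applies.\<close>

lemma convergent_from_rationals:
  fixes f :: "nat \<Rightarrow> real \<Rightarrow> 'a::banach"
  assumes rat: "\<And>q. q \<in> \<rat> \<Longrightarrow> 0 \<le> q \<Longrightarrow> convergent (\<lambda>n. f n q)"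
    and inc: "\<And>n s t. 0 \<le> s \<Longrightarrow> s \<le> t \<Longrightarrow> norm (f n t - f n s) \<le> C * (t - s + h n)"
    and C: "0 \<le> C" and h: "h \<longlonglongrightarrow> 0" and t: "0 \<le> t"
  shows "convergent (\<lambda>n. f n t)"
proof -
  have "Cauchy (\<lambda>n. f n t)"
  proof (rule CauchyI)
    fix e :: real assume e: "0 < e"
    define d where "d = e / (6 * (C + 1))"
    have d: "0 < d" using e C by (simp add: d_def)
    have Cd: "C * (2 * d) \<le> e / 3"
    proof -
      have "C * (2 * d) \<le> (C + 1) * (2 * d)" using d by (intro mult_right_mono) auto
      also have "\<dots> = e / 3" using C by (simp add: d_def field_simps)
      finally show ?thesis .
    qed
    obtain q where q: "q \<in> \<rat>" "t < q" "q < t + d" using Rats_dense_in_real[of t "t + d"] d by auto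
    have "Cauchy (\<lambda>n. f n q)" using rat[of q] q t by (simp add: convergent_Cauchy)
    then obtain N1 where N1: "\<And>m n. N1 \<le> m \<Longrightarrow> N1 \<le> n \<Longrightarrow> norm (f m q - f n q) < e / 3"
      using e by (metis CauchyD divide_pos_pos zero_less_numeral)
    obtain N2 where N2: "\<And>n. N2 \<le> n \<Longrightarrow> h n < d"
      using order_tendstoD(2)[OF h d] by (auto simp: eventually_sequentially)
    have near: "norm (f n q - f n t) \<le> e / 3" if "N2 \<le> n" for n
    proof -
      have "norm (f n q - f n t) \<le> C * (q - t + h n)" using inc t q by simp
      also have "\<dots> \<le> C * (2 * d)" using N2[OF that] q C by (intro mult_left_mono) auto
      finally show ?thesis using Cd by simp
    qed
    show "\<exists>M. \<forall>m\<ge>M. \<forall>n\<ge>M. norm (f m t - f n t) < e"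
    proof (intro exI[of _ "max N1 N2"] allI impI)
      fix m n assume mn: "max N1 N2 \<le> m" "max N1 N2 \<le> n"
      have eq: "f m t - f n t = (f m q - f n q) + (f n q - f n t) - (f m q - f m t)" by simp
      have "norm (f m t - f n t) \<le> norm (f m q - f n q) + norm (f n q - f n t) + norm (f m q - f m t)"
        unfolding eq using norm_triangle_ineq4[of "(f m q - f n q) + (f n q - f n t)" "f m q - f m t"]
          norm_triangle_ineq[of "f m q - f n q" "f n q - f n t"] by linarith
      then show "norm (f m t - f n t) < e"
        using N1[of m n] near[of m] near[of n] mn by simp
    qed
  qed
  then show ?thesis by (rule Cauchy_convergent)
qed

lemma pointwise_convergent_subsequence:
  fixes f :: "nat \<Rightarrow> real \<Rightarrow> 'a::euclidean_space"
  assumes bd: "\<And>n t. 0 \<le> t \<Longrightarrow> norm (f n t) \<le> B * (1 + t)"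
    and inc: "\<And>n s t. 0 \<le> s \<Longrightarrow> s \<le> t \<Longrightarrow> norm (f n t - f n s) \<le> C * (t - s + h n)"
    and C: "0 \<le> C" and h: "h \<longlonglongrightarrow> 0"
  obtains k where "strict_mono (k :: nat \<Rightarrow> nat)" "\<And>t. 0 \<le> t \<Longrightarrow> convergent (\<lambda>n. f (k n) t)"
proof -
  \<comment> \<open>The selection theorem asks for a bound uniform in t, while positions may grow
    linearly; hence the division by 1 + t.\<close>
  let ?S = "{q \<in> \<rat>. (0::real) \<le> q}" and ?g = "\<lambda>n t. (1 / (1 + t)) *\<^sub>R f n t"
  have cS: "countable ?S" by (rule countable_subset[OF _ countable_rat]) auto
  have gB: "norm (?g n t) \<le> B" if "t \<in> ?S" for n t
    using bd[of t n] that by (simp add: divide_le_eq mult.commute)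
  obtain k where k: "strict_mono (k :: nat \<Rightarrow> nat)" "\<And>t. t \<in> ?S \<Longrightarrow> \<exists>l. (\<lambda>n. ?g (k n) t) \<longlonglongrightarrow> l"
    using function_convergent_subsequence[where f = ?g, OF cS gB] by blast
  have rat: "convergent (\<lambda>n. f (k n) q)" if q: "q \<in> \<rat>" "0 \<le> q" for q
  proof -
    obtain l where "(\<lambda>n. ?g (k n) q) \<longlonglongrightarrow> l" using k(2)[of q] q by auto
    from tendsto_scaleR[OF tendsto_const[of "1 + q"] this]
    have "(\<lambda>n. f (k n) q) \<longlonglongrightarrow> (1 + q) *\<^sub>R l" using q by simp
    then show ?thesis by (auto simp: convergent_def)
  qed
  have hk: "(\<lambda>n. h (k n)) \<longlonglongrightarrow> 0" using LIMSEQ_subseq_LIMSEQ[OF h k(1)] by (simp add: o_def)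
  show thesis
  proof (rule that[OF k(1)])
    fix t :: real assume t: "0 \<le> t"
    show "convergent (\<lambda>n. f (k n) t)"
      by (rule convergent_from_rationals[where f = "\<lambda>n. f (k n)" and h = "\<lambda>n. h (k n)", OF rat inc C hk t])
  qed
qed

lemma null_sets_liminf:
  assumes B: "\<And>m n :: nat. B m n \<in> sets M" and le: "\<And>m n. emeasure M (B m n) \<le> ennreal ((1 / 2) ^ m)"
  shows "(\<Inter>m. \<Union>k. \<Inter>n\<in>{k..}. B m n) \<in> null_sets M"
proof -
  let ?C = "\<lambda>m k. \<Inter>n\<in>{k..}. B m n"
  have C: "?C m k \<in> sets M" for m k using B by (intro sets.countable_INT') auto
  have "emeasure M (\<Union>k. ?C m k) \<le> ennreal ((1 / 2) ^ m)" for m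
  proof -
    have "incseq (?C m)" by (rule incseq_SucI) auto
    then have "emeasure M (\<Union>k. ?C m k) = (SUP k. emeasure M (?C m k))"
      using C by (intro SUP_emeasure_incseq[symmetric]) auto
    also have "\<dots> \<le> ennreal ((1 / 2) ^ m)"
    proof (rule SUP_least)
      fix k
      have "emeasure M (?C m k) \<le> emeasure M (B m k)" using B by (intro emeasure_mono) auto
      with le show "emeasure M (?C m k) \<le> ennreal ((1 / 2) ^ m)" by (rule order_trans[rotated])
    qed
    finally show ?thesis .
  qed
  note le1 = this
  have U: "(\<Union>k. ?C m k) \<in> sets M" for m using C by (intro sets.countable_UN) auto
  have le2: "emeasure M (\<Inter>m. \<Union>k. ?C m k) \<le> ennreal ((1 / 2) ^ m)" for m
  proof -
    have "emeasure M (\<Inter>m. \<Union>k. ?C m k) \<le> emeasure M (\<Union>k. ?C m k)"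
      by (rule emeasure_mono[OF _ U]) (rule INT_lower[OF UNIV_I])
    then show ?thesis using le1 by (rule order_trans)
  qed
  have "(\<lambda>m. ennreal ((1 / 2) ^ m)) \<longlonglongrightarrow> ennreal 0"
    by (intro tendsto_ennrealI LIMSEQ_realpow_zero) auto
  then have "emeasure M (\<Inter>m. \<Union>k. ?C m k) \<le> ennreal 0"
    by (rule LIMSEQ_le_const) (intro exI allI impI le2)
  moreover have "(\<Inter>m. \<Union>k. ?C m k) \<in> sets M"
    by (rule sets.countable_INT') (simp_all only: countableI_type UNIV_not_empty not_False_eq_True image_subset_iff U ball_simps simp_thms)
  ultimately show ?thesis unfolding null_sets_def by simp
qed

section \<open>Selection of good steps and the exceptional set\<close>

context cs_kernel
begin

text \<open>Compactness holds for every datum and every step sequence tending to 0, so it can be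
  applied after the steps have been thinned out to those avoiding the bad sets.\<close>

lemma exists_limit:
  fixes x v :: "real ^ 'd ^ 'n"
  assumes h: "\<And>n. 0 < h n" "\<And>n. h n * K 0 \<le> 1" "h \<longlonglongrightarrow> 0"
  obtains k X V where "strict_mono (k :: nat \<Rightarrow> nat)" "cs_scheme_limit K (h \<circ> k) x v X V"
proof -
  define R where "R = max (norm x) (norm v)"
  have Rx: "norm (x $ j) \<le> R" and Rv: "norm (v $ j) \<le> R" for j
    unfolding R_def by (meson Finite_Cartesian_Product.norm_nth_le max.coboundedI1 max.coboundedI2)+
  have R: "0 \<le> R" by (simp add: R_def max.coboundedI1)
  define N where "N = real CARD('n)"
  have N: "0 \<le> N" by (simp add: N_def)
  let ?f = "\<lambda>n t. cs_scheme K (h n) t (x, v)"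
  have norm_z: "norm z \<le> N * A + N * B" if "\<And>i. norm (fst z $ i) \<le> A" "\<And>i. norm (snd z $ i) \<le> B"
    for z :: "('d, 'n) phase" and A B
  proof -
    have "norm z \<le> norm (fst z) + norm (snd z)"
      using sqrt_sum_squares_le_sum[of "norm (fst z)" "norm (snd z)"] by (simp add: norm_prod_def)
    also have "\<dots> \<le> N * A + N * B" unfolding N_def by (intro add_mono norm_le_card_mult that)
    finally show ?thesis .
  qed
  have bd: "norm (?f n t) \<le> 2 * N * R * (1 + t)" if t: "0 \<le> t" for n t
  proof -
    have "norm (?f n t) \<le> N * (R + t * R) + N * R"
      by (rule norm_z[OF cs_scheme_bounds(2)[OF h(1,2) t Rx Rv] cs_scheme_bounds(1)[OF h(1,2) t Rx Rv]])
    also have "\<dots> \<le> 2 * N * R * (1 + t)" using N R t by (simp add: algebra_simps)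
    finally show ?thesis .
  qed
  have inc: "norm (?f n t - ?f n s) \<le> (N * R + N * (2 * K 0 * R)) * (t - s + h n)"
    if st: "0 \<le> s" "s \<le> t" for n s t
  proof -
    have "norm (?f n t - ?f n s) \<le> N * (R * (t - s + h n)) + N * (2 * K 0 * R * (t - s + h n))"
      by (rule norm_z)
        (simp_all only: fst_diff snd_diff vector_minus_component cs_scheme_increment_le[OF h(1,2) st Rv])
    then show ?thesis by (simp add: algebra_simps)
  qed
  have "0 \<le> N * R + N * (2 * K 0 * R)" using N R K0_pos by simp
  then obtain k where k: "strict_mono (k :: nat \<Rightarrow> nat)" "\<And>t. 0 \<le> t \<Longrightarrow> convergent (\<lambda>n. ?f (k n) t)"
    using pointwise_convergent_subsequence[where f = ?f, OF bd inc _ h(3)] by blast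
  have "cs_scheme_limit K (h \<circ> k) x v (\<lambda>t. fst (lim (\<lambda>n. ?f (k n) t))) (\<lambda>t. snd (lim (\<lambda>n. ?f (k n) t)))"
  proof (unfold_locales)
    show "0 < (h \<circ> k) n" "(h \<circ> k) n * K 0 \<le> 1" for n using h by simp_all
    show "(h \<circ> k) \<longlonglongrightarrow> 0" by (rule LIMSEQ_subseq_LIMSEQ[OF h(3) k(1)])
    show "(\<lambda>n. cs_scheme K ((h \<circ> k) n) t (x, v)) \<longlonglongrightarrow> (fst (lim (\<lambda>n. ?f (k n) t)), snd (lim (\<lambda>n. ?f (k n) t)))"
      if "0 \<le> t" for t
      using k(2)[OF that] by (simp add: convergent_LIMSEQ_iff)
  qed
  then show thesis by (rule that[OF k(1)])
qed

text \<open>m is the measure level, n the step index, and j bounds the time horizon and the size of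
  the datum at once.\<close>

definition exceptional :: "(nat \<Rightarrow> real) \<Rightarrow> (nat \<Rightarrow> nat \<Rightarrow> (real \<times> ('d::finite, 'n::finite) phase set) set) \<Rightarrow> ('d, 'n) phase set" where
  "exceptional h Q = (\<Inter>m. \<Union>k. \<Inter>n\<in>{k..}. \<Union>j. \<Union>(t, A)\<in>Q m j. cs_scheme K (h n) t -` A)"

text \<open>The factor exp(-c j) cancels the volume distortion up to time j, and the geometric
  weights in j sum to one, leaving 2^-m for each step.\<close>

lemma null_sets_exceptional:
  fixes Q :: "nat \<Rightarrow> nat \<Rightarrow> (real \<times> ('d::finite, 'n::finite) phase set) set"
  assumes h: "\<And>n. 0 < h n" "\<And>n. (2 * real CARD('n) * K 0 + 1) * h n \<le> 1 / 2"
    and c: "c = 4 * (2 * real CARD('n) * K 0 + 1) * DIM(('d, 'n) phase)"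
    and Q: "\<And>m j. finite (Q m j)" "\<And>m j t A. (t, A) \<in> Q m j \<Longrightarrow> 0 \<le> t \<and> t \<le> real j \<and> open A"
    and sum: "\<And>m j. (\<Sum>(t, A)\<in>Q m j. emeasure lborel A) \<le> ennreal ((1 / 2) ^ m * (1 / 2) ^ Suc j * exp (- c * real j))"
  shows "exceptional h Q \<in> null_sets lborel"
  unfolding exceptional_def
proof (rule null_sets_liminf)
  fix m n
  let ?P = "\<lambda>q. cs_scheme K (h n) (fst q) -` snd q"
  have c0: "0 \<le> c" using K0_pos by (simp add: c)
  have Ps: "?P q \<in> sets borel" if "q \<in> Q m j" for q j
    using emeasure_cs_scheme_vimage_le(1)[OF h(1,2)[of n], of "snd q" "fst q"] Q(2)[of "fst q" "snd q" m j] that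
    by simp
  have P: "emeasure lborel (?P q) \<le> ennreal (exp (c * real j)) * emeasure lborel (snd q)" if "q \<in> Q m j" for q j
  proof -
    have q: "0 \<le> fst q" "fst q \<le> real j" "open (snd q)" using Q(2)[of "fst q" "snd q" m j] that by auto
    have "emeasure lborel (?P q) \<le> ennreal (exp (c * fst q)) * emeasure lborel (snd q)"
      unfolding c by (rule emeasure_cs_scheme_vimage_le(2)[OF h(1,2)]) (use q in auto)
    also have "\<dots> \<le> ennreal (exp (c * real j)) * emeasure lborel (snd q)"
      using q c0 by (intro mult_right_mono ennreal_leI) (auto intro: mult_left_mono)
    finally show ?thesis .
  qed
  have Uj: "(\<Union>q\<in>Q m j. ?P q) \<in> sets borel" for j using Ps Q(1) by (intro sets.finite_UN) auto
  have le: "emeasure lborel (\<Union>q\<in>Q m j. ?P q) \<le> ennreal ((1 / 2) ^ m) * ennreal ((1 / 2) ^ Suc j)" for j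
  proof -
    have "emeasure lborel (\<Union>q\<in>Q m j. ?P q) \<le> (\<Sum>q\<in>Q m j. emeasure lborel (?P q))"
      using Q(1) Ps by (intro emeasure_subadditive_finite) auto
    also have "\<dots> \<le> (\<Sum>q\<in>Q m j. ennreal (exp (c * real j)) * emeasure lborel (snd q))"
      by (intro sum_mono P)
    also have "\<dots> = ennreal (exp (c * real j)) * (\<Sum>(t, A)\<in>Q m j. emeasure lborel A)"
      by (simp add: sum_distrib_left case_prod_unfold)
    also have "\<dots> \<le> ennreal (exp (c * real j)) * ennreal ((1 / 2) ^ m * (1 / 2) ^ Suc j * exp (- c * real j))"
      by (intro mult_left_mono sum) simp
    also have "\<dots> = ennreal (exp (c * real j) * ((1 / 2) ^ m * (1 / 2) ^ Suc j * exp (- c * real j)))"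
      by (simp only: ennreal_mult exp_ge_zero mult_nonneg_nonneg zero_le_power zero_le_divide_1_iff zero_le_numeral)
    also have "exp (c * real j) * ((1 / 2) ^ m * (1 / 2) ^ Suc j * exp (- c * real j)) = (1 / 2) ^ m * (1 / 2) ^ Suc j"
      by (simp add: exp_minus field_simps)
    also have "ennreal ((1 / 2) ^ m * (1 / 2) ^ Suc j) = ennreal ((1 / 2) ^ m) * ennreal ((1 / 2) ^ Suc j)"
      by (rule ennreal_mult) simp_all
    finally show ?thesis .
  qed
  have eq: "(\<Union>j. \<Union>(t, A)\<in>Q m j. cs_scheme K (h n) t -` A) = (\<Union>j. \<Union>q\<in>Q m j. ?P q)"
    by (auto simp: case_prod_unfold)
  show "(\<Union>j. \<Union>(t, A)\<in>Q m j. cs_scheme K (h n) t -` A) \<in> sets lborel"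
    unfolding eq using Uj by auto
  have half: "(\<Sum>j. ennreal ((1 / 2) ^ Suc j)) = 1"
  proof -
    have "(\<Sum>j. ennreal ((1 / 2) ^ Suc j)) = ennreal 1"
      by (rule suminf_ennreal_eq[OF _ power_half_series]) simp
    then show ?thesis by (simp only: ennreal_1)
  qed
  have "emeasure lborel (\<Union>j. \<Union>q\<in>Q m j. ?P q) \<le> (\<Sum>j. emeasure lborel (\<Union>q\<in>Q m j. ?P q))"
    using Uj by (intro emeasure_subadditive_countably) auto
  also have "\<dots> \<le> (\<Sum>j. ennreal ((1 / 2) ^ m) * ennreal ((1 / 2) ^ Suc j))"
    by (intro suminf_le le) auto
  also have "\<dots> = ennreal ((1 / 2) ^ m)"
    by (simp only: ennreal_suminf_cmult half mult_1_right)
  finally show "emeasure lborel (\<Union>j. \<Union>(t, A)\<in>Q m j. cs_scheme K (h n) t -` A) \<le> ennreal ((1 / 2) ^ m)"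
    unfolding eq .
qed

text \<open>Openness of the catching sets links limit and scheme: a limit state in such a set forces
  the discrete states into it for all late steps, although the selected steps avoid it.\<close>

lemma almost_everywhere_transversal_limit:
  obtains Z :: "('d::finite, 'n::finite) phase set"
  where "Z \<in> null_sets lborel"
    "\<And>x v. (x, v) \<notin> Z \<Longrightarrow> \<exists>h X V. cs_scheme_limit K h x v X V \<and> (\<forall>t\<ge>0. transversal (X t) (V t))"
proof -
  define c where "c = 4 * (2 * real CARD('n) * K 0 + 1) * DIM(('d, 'n) phase)"
  define a where "a = 2 * real CARD('n) * K 0 + 1"
  have a: "K 0 \<le> a" "0 < a"
  proof -
    have "1 * K 0 \<le> real CARD('n) * K 0"
      using K0_pos by (intro mult_right_mono) (auto simp: Suc_le_eq)
    then show "K 0 \<le> a" "0 < a" using K0_pos unfolding a_def by linarith+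
  qed
  define h where "h n = 1 / (2 * a) * (1 / real (Suc n))" for n
  have h0: "0 < h n" and ha: "a * h n \<le> 1 / 2" for n using a by (simp_all add: h_def)
  have hK: "h n * K 0 \<le> 1" for n
  proof -
    have "h n * K 0 \<le> h n * a" using a(1) h0[of n] by (intro mult_left_mono) auto
    then show ?thesis using ha[of n] by (simp add: mult.commute)
  qed
  have h_lim: "h \<longlonglongrightarrow> 0"
  proof -
    have "h = (\<lambda>n. 1 / (2 * a) * inverse (real (Suc n)))" by (simp add: h_def fun_eq_iff inverse_eq_divide)
    with tendsto_mult_right_zero[OF LIMSEQ_inverse_real_of_nat] show ?thesis by (simp only:)
  qed
  \<comment> \<open>For a datum of size at most j, positions up to time j are bounded by j + j * j
    and velocities are Lipschitz with constant 2 K(0) j.\<close>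
  define ok where "ok m j Q \<longleftrightarrow> finite Q \<and> (\<forall>t A. (t, A) \<in> Q \<longrightarrow> 0 \<le> t \<and> t \<le> real j \<and> open A) \<and>
      (\<Sum>(t, A)\<in>Q. emeasure lborel A) \<le> ennreal ((1 / 2) ^ m * (1 / 2) ^ Suc j * exp (- c * real j)) \<and>
      catches (real j + real j * real j) (2 * K 0 * real j) (real j) Q"
    for m j and Q :: "(real \<times> ('d, 'n) phase set) set"
  define Q where "Q m j = (SOME Q. ok m j Q)" for m j
  have "ok m j (Q m j)" for m j
    unfolding Q_def
  proof (rule someI_ex)
    have "0 \<le> real j + real j * real j" "0 \<le> 2 * K 0 * real j" "0 \<le> real j"
      "0 < (1 / 2) ^ m * (1 / 2) ^ Suc j * exp (- c * real j)"
      using K0_pos by simp_all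
    from finite_catching_family[OF this] show "\<exists>Q. ok m j Q" unfolding ok_def by metis
  qed
  then have Q: "\<And>m j. finite (Q m j)" "\<And>m j t A. (t, A) \<in> Q m j \<Longrightarrow> 0 \<le> t \<and> t \<le> real j \<and> open A"
      "\<And>m j. (\<Sum>(t, A)\<in>Q m j. emeasure lborel A) \<le> ennreal ((1 / 2) ^ m * (1 / 2) ^ Suc j * exp (- c * real j))"
      "\<And>m j. catches (real j + real j * real j) (2 * K 0 * real j) (real j) (Q m j)"
    unfolding ok_def by blast+
  show thesis
  proof (rule that)
    show "exceptional h Q \<in> null_sets lborel"
    proof (rule null_sets_exceptional[where h = h and c = c and Q = Q])
      show "(2 * real CARD('n) * K 0 + 1) * h n \<le> 1 / 2" for n using ha[of n] by (simp only: a_def)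
    qed (fact h0 c_def Q(1) Q(3) | erule Q(2))+
    fix x v :: "real ^ 'd ^ 'n"
    assume xv: "(x, v) \<notin> exceptional h Q"
    define bad where "bad m n = (\<Union>j. \<Union>(t, A)\<in>Q m j. cs_scheme K (h n) t -` A)" for m n
    have "exceptional h Q = (\<Inter>m. \<Union>k. \<Inter>n\<in>{k..}. bad m n)"
      unfolding exceptional_def bad_def ..
    \<comment> \<open>One level m works for infinitely many steps, each avoiding the bad sets of all
      horizons j simultaneously; j can therefore be chosen after the limit.\<close>
    with xv obtain m where m: "\<forall>k. \<exists>n\<in>{k..}. (x, v) \<notin> bad m n"
      by auto
    have "infinite {n. (x, v) \<notin> bad m n}"
      unfolding infinite_nat_iff_unbounded_le
    proof
      fix k
      show "\<exists>n\<ge>k. n \<in> {n. (x, v) \<notin> bad m n}" using m[rule_format, of k] by auto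
    qed
    from infinite_enumerate[OF this] obtain r where r: "strict_mono (r :: nat \<Rightarrow> nat)"
      and good: "\<And>n. (x, v) \<notin> bad m (r n)"
      by auto
    obtain k X V where k: "strict_mono (k :: nat \<Rightarrow> nat)" and lim: "cs_scheme_limit K ((h \<circ> r) \<circ> k) x v X V"
    proof (rule exists_limit[of "h \<circ> r" x v])
      show "(h \<circ> r) \<longlonglongrightarrow> 0" by (rule LIMSEQ_subseq_LIMSEQ[OF h_lim r])
    qed (simp_all add: h0 hK that)
    interpret L: cs_scheme_limit K "(h \<circ> r) \<circ> k" x v X V by (rule lim)
    have "transversal (X s) (V s)" if s: "0 \<le> s" for s
    proof (rule ccontr)
      assume nt: "\<not> transversal (X s) (V s)"
      obtain j :: nat where j: "max s (max (norm x) (norm v)) \<le> real j" using real_arch_simple by blast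
      have xj: "norm (x $ i) \<le> real j" and vj: "norm (v $ i) \<le> real j" for i
        using j Finite_Cartesian_Product.norm_nth_le[of x i] Finite_Cartesian_Product.norm_nth_le[of v i] by linarith+
      have X: "norm (X t $ i) \<le> real j + real j * real j" if "0 \<le> t" "t \<le> real j" for t i
        using L.norm_X_le[OF xj vj that(1), of i] mult_right_mono[OF that(2), of "real j"] by linarith
      have V: "norm (V t $ i) \<le> real j + real j * real j" if "0 \<le> t" "t \<le> real j" for t i
        using L.norm_V_le[OF vj that(1), of i] by (simp add: add_increasing2)
      have dX: "norm (X t $ i - X r $ i) \<le> (real j + real j * real j) * (t - r)" if "0 \<le> r" "r \<le> t" for r t i
        by (rule order_trans[OF L.X_increment_le[OF vj that]]) (use that in \<open>auto intro!: mult_right_mono\<close>)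
      have dV: "norm (V t $ i - V r $ i) \<le> 2 * K 0 * real j * (t - r)" if "0 \<le> r" "r \<le> t" for r t i
        by (rule L.V_increment_le[OF vj that])
      have "\<exists>(t, A)\<in>Q m j. (X t, V t) \<in> A"
        by (rule Q(4)[of j m, unfolded catches_def, rule_format, of s X V]) (use s j X V dX dV nt in auto)
      then obtain t A where tA: "(t, A) \<in> Q m j" "(X t, V t) \<in> A" by blast
      with Q(2) have "0 \<le> t" "open A" by blast+
      then have "\<forall>\<^sub>F n in sequentially. cs_scheme K (((h \<circ> r) \<circ> k) n) t (x, v) \<in> A"
        using topological_tendstoD[OF L.lim] tA(2) by blast
      then obtain n where "cs_scheme K (((h \<circ> r) \<circ> k) n) t (x, v) \<in> A"
        by (auto simp: eventually_sequentially)
      with tA(1) have "(x, v) \<in> bad m (r (k n))" unfolding bad_def by auto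
      with good show False by blast
    qed
    with lim show "\<exists>h X V. cs_scheme_limit K h x v X V \<and> (\<forall>t\<ge>0. transversal (X t) (V t))" by blast
  qed
qed

end

theorem theorem3p1:
  fixes K :: "real \<Rightarrow> real"
  assumes K_pos: "\<forall>r\<in>{0..1}. 0 < K r"
    and K_decreasing: "antimono_on {0..1} K"
    and K_Lipschitz: "\<exists>L. L-lipschitz_on {0..1} K"
  shows "\<exists>Z :: ((real ^ 'd ^ 'n) \<times> (real ^ 'd ^ 'n)) set.
    Z \<in> null_sets lebesgue \<and>
    (\<forall>x v. (x, v) \<notin> Z \<longrightarrow>
      (\<exists>X V. topological_CS_solution K x v X V \<and>
        (\<forall>X' V'. topological_CS_solution K x v X' V' \<longrightarrow>
           (\<forall>t\<ge>0. X' t = X t \<and> V' t = V t)) \<and>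
        (\<forall>Rx>0. \<forall>Rv>0. (\<forall>i. norm (x $ i) \<le> Rx \<and> norm (v $ i) \<le> Rv) \<longrightarrow>
           (\<forall>i. (\<forall>t\<ge>0. norm (X t $ i) \<le> Rx + t * Rv \<and> norm (V t $ i) \<le> Rv) \<and>
                (2 * Rv * K 0)-lipschitz_on {0..} (\<lambda>t. V t $ i)))))"
proof -
  interpret cs_kernel K using K_pos K_decreasing by unfold_locales auto
  obtain Z :: "('d, 'n) phase set" where Z: "Z \<in> null_sets lborel"
    and lim: "\<And>x v. (x, v) \<notin> Z \<Longrightarrow> \<exists>h X V. cs_scheme_limit K h x v X V \<and> (\<forall>t\<ge>0. transversal (X t) (V t))"
    using almost_everywhere_transversal_limit by metis
  show ?thesis
  proof (intro exI[of _ Z] conjI allI impI)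
    show "Z \<in> null_sets lebesgue" using Z by (rule null_sets_completionI)
    fix x v :: "real ^ 'd ^ 'n" assume "(x, v) \<notin> Z"
    from lim[OF this] obtain h X V where L: "cs_scheme_limit K h x v X V"
      and tr: "\<And>t. 0 \<le> t \<Longrightarrow> transversal (X t) (V t)" by blast
    interpret L: cs_scheme_limit K h x v X V by (rule L)
    note sol = L.is_solution[OF tr]
    show "\<exists>X V. topological_CS_solution K x v X V \<and>
        (\<forall>X' V'. topological_CS_solution K x v X' V' \<longrightarrow>
           (\<forall>t\<ge>0. X' t = X t \<and> V' t = V t)) \<and>
        (\<forall>Rx>0. \<forall>Rv>0. (\<forall>i. norm (x $ i) \<le> Rx \<and> norm (v $ i) \<le> Rv) \<longrightarrow>
           (\<forall>i. (\<forall>t\<ge>0. norm (X t $ i) \<le> Rx + t * Rv \<and> norm (V t $ i) \<le> Rv) \<and>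
                (2 * Rv * K 0)-lipschitz_on {0..} (\<lambda>t. V t $ i)))"
    proof (rule exI[of _ X], rule exI[of _ V], intro conjI)
      show "topological_CS_solution K x v X V" by (rule sol)
      show "\<forall>X' V'. topological_CS_solution K x v X' V' \<longrightarrow> (\<forall>t\<ge>0. X' t = X t \<and> V' t = V t)"
        using uniqueness[OF sol _ tr] by blast
      show "\<forall>Rx>0. \<forall>Rv>0. (\<forall>i. norm (x $ i) \<le> Rx \<and> norm (v $ i) \<le> Rv) \<longrightarrow>
           (\<forall>i. (\<forall>t\<ge>0. norm (X t $ i) \<le> Rx + t * Rv \<and> norm (V t $ i) \<le> Rv) \<and>
                (2 * Rv * K 0)-lipschitz_on {0..} (\<lambda>t. V t $ i))"
        by (intro allI impI conjI L.norm_X_le L.norm_V_le L.V_lipschitz) blast+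
    qed
  qed
qed

end
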